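(* Suppose that $|\gamma_1\tau^{-1}|<q^{1/2}$ and $|\gamma_2^{-1}\tau|<q^{1/2}$. Let $$\mathcal{W}_\xi(g)=\frac{(1-\gamma_1\tau^{-1}q^{-1/2})(1-\gamma_2^{-1}\tau q^{-1/2})}{1-\gamma_1\gamma_2^{-1}q^{-1}}\,Wa_\xi(g)\qquad(g\in GL(2,F)).$$ Then for every integer $k\ge 0$, $$\mathcal{W}_\xi(\eta_k)=(1-q^{-1})^{-1}q^{-k/2}\left[\gamma_1^k\,\frac{(1-\gamma_2\tau^{-1}q^{-1/2})(1-\gamma_1^{-1}\tau q^{-1/2})}{1-\gamma_1^{-1}\gamma_2}+\gamma_2^k\,\frac{(1-\gamma_1\tau^{-1}q^{-1/2})(1-\gamma_2^{-1}\tau q^{-1/2})}{1-\gamma_1\gamma_2^{-1}}\right]$$ (when $\gamma_1=\gamma_2$ the right-hand side is interpreted by analytic continuation, the expression being analytic there after cancellation). In particular, the function $\mathcal{W}_\xi$, originally defined by an integral when $|\gamma_1\tau^{-1}|<q^{1/2}$ and $|\gamma_2^{-1}\tau|<q^{1/2}$, has (for each fixed $g$) holomorphic continuation to all $\gamma_1,\gamma_2,\tau\in\mathbb{C}^\times$, and is invariant under the interchange of $\gamma_1$ and $\gamma_2$.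
   Context: $F$ is a nonarchimedean local field of characteristic different from $2$, with ring of integers $\mathcal{O}$, uniformizer $\varpi$, residue field of cardinality $q$, and absolute value $|\cdot|_F$ normalized by $|\varpi|_F=q^{-1}$. $G_2=GL(2,F)$, $K_2=GL(2,\mathcal{O})$, $B_2\subset G_2$ is the group of upper triangular matrices, with modular character $\delta_{B_2}$. $\xi_1,\xi_2,\sigma$ are unramified quasicharacters of $F^\times$ with $\xi_i(\varpi)=\gamma_i$ ($i=1,2$) and $\sigma(\varpi)=\tau$. $\xi$ is the character $\xi\begin{pmatrix}a&b\\0&d\end{pmatrix}=\xi_1(a)\xi_2(d)$ of $B_2$. $\mathrm{Ind}(\xi)$ is the space of locally constant functions $f:G_2\to\mathbb{C}$ with $f(bg)=\xi(b)\delta_{B_2}^{1/2}(b)f(g)$ for $b\in B_2$, $g\in G_2$, on which $G_2$ acts by right translation $\pi_2$. For $f\in\mathrm{Ind}(\xi)$ put $$W(f)=\int_{F^\times}f\left(\begin{pmatrix}0&1\\1&0\end{pmatrix}\begin{pmatrix}1&1\\0&1\end{pmatrix}\begin{pmatrix}a&0\\0&1\end{pmatrix}\right)\sigma^{-1}(a)\,d^\times a,$$ where $d^\times a$ is the Haar measure giving $\mathcal{O}^\times$ measure $1$; the integral converges absolutely when $|\gamma_1\tau^{-1}|<q^{1/2}$ and $|\gamma_2^{-1}\tau|<q^{1/2}$. Let $\phi_\xi\in\mathrm{Ind}(\xi)$ be the $K_2$-fixed vector with $\phi_\xi(I_2)=1$, and set $Wa_\xi(g)=W(\pi_2(g)\phi_\xi)$.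 For $k\ge 0$ let $$\eta_k=\begin{pmatrix}1&1\\0&1\end{pmatrix}\begin{pmatrix}\varpi^k&0\\0&1\end{pmatrix}.$$ *)

theory Defs
  imports "HOL-Analysis.Analysis"
begin

section \<open>Nonarchimedean local fields\<close>

text \<open>
  A nonarchimedean local field is a field that is complete for a discrete nontrivial
  nonarchimedean absolute value with finite residue field. The metric of the
  type (hence its topology, compactness, Borel sets) is the one induced by the absolute value
  \<open>absF\<close>; in particular \<open>absF x = dist x 0\<close> is nonnegative and vanishes only at \<open>0\<close>.
  In the last axiom, \<open>p\<close> is a uniformizer, i.e. a nonzero generator of the maximal ideal; the
  equation \<open>absF p = 1/q\<close>, where \<open>q\<close> is the cardinality of the residue field (a quotient
  of the ring of integers by congruence modulo the maximal ideal), normalizes the absolute value.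
\<close>

class nonarch_local_field = field + complete_space +
  fixes absF :: "'a \<Rightarrow> real"
  assumes dist_absF: "dist x y = absF (x - y)"
    and absF_mult: "absF (x * y) = absF x * absF y"
    and absF_ultrametric: "absF (x + y) \<le> max (absF x) (absF y)"
    and finite_residue:
      "finite ({x. absF x \<le> 1} // {(x, y). absF x \<le> 1 \<and> absF y \<le> 1 \<and> absF (x - y) < 1})"
    and ex_uniformizer:
      "\<exists>p. p \<noteq> 0 \<and> {x. absF x < 1} = (*) p ` {x. absF x \<le> 1} \<and>
           absF p = 1 / real (card
             ({x. absF x \<le> 1} // {(x, y). absF x \<le> 1 \<and> absF y \<le> 1 \<and> absF (x - y) < 1}))"

definition ring_of_integers :: "'a::nonarch_local_field set"
  where "ring_of_integers = {x. absF x \<le> 1}"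

definition residue_field :: "'a::nonarch_local_field set set"
  where "residue_field = ring_of_integers //
    {(x, y). x \<in> ring_of_integers \<and> y \<in> ring_of_integers \<and> absF (x - y) < 1}"

definition uniformizer :: "'a::nonarch_local_field \<Rightarrow> bool"
  where "uniformizer p \<longleftrightarrow> p \<noteq> 0 \<and> {x. absF x < 1} = (*) p ` ring_of_integers"

text \<open>
  Characters of \<open>F\<^sup>\<times>\<close> are functions on all of \<open>F\<close> whose value at \<open>0\<close> is irrelevant.
\<close>

definition unramified_quasicharacter :: "('a::nonarch_local_field \<Rightarrow> complex) \<Rightarrow> bool"
  where "unramified_quasicharacter \<omega> \<longleftrightarrow>
    (\<forall>x. x \<noteq> 0 \<longrightarrow> \<omega> x \<noteq> 0) \<and>
    (\<forall>x y. x \<noteq> 0 \<longrightarrow> y \<noteq> 0 \<longrightarrow> \<omega> (x * y) = \<omega> x * \<omega> y) \<and>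
    continuous_on (- {0}) \<omega> \<and>
    (\<forall>u. absF u = 1 \<longrightarrow> \<omega> u = 1)"

text \<open>
  The Haar measure \<open>d\<^sup>\<times>a\<close>, as a measure on the Borel sets of the space \<open>F - {0}\<close>.
  As \<open>F\<^sup>\<times>\<close> is second countable, local finiteness makes the measure Radon.
\<close>

definition mult_haar_measure :: "'a::nonarch_local_field measure \<Rightarrow> bool"
  where "mult_haar_measure \<mu> \<longleftrightarrow>
    sets \<mu> = sets (restrict_space borel (- {0})) \<and>
    (\<forall>c A. c \<noteq> 0 \<longrightarrow> A \<in> sets \<mu> \<longrightarrow> emeasure \<mu> ((*) c ` A) = emeasure \<mu> A) \<and>
    (\<forall>C. compact C \<longrightarrow> C \<subseteq> - {0} \<longrightarrow> emeasure \<mu> C < \<infinity>) \<and>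
    emeasure \<mu> {u. absF u = 1} = 1"


section \<open>\<open>GL(2,F)\<close> and the induced representation\<close>

definition mat2 :: "'a \<Rightarrow> 'a \<Rightarrow> 'a \<Rightarrow> 'a \<Rightarrow> 'a::zero^2^2"
  where "mat2 a b c d = vector [vector [a, b], vector [c, d]]"

definition GL2 :: "('a::nonarch_local_field^2^2) set"
  where "GL2 = {g. invertible g}"

definition integral_matrices :: "('a::nonarch_local_field^2^2) set"
  where "integral_matrices = {g. \<forall>i j. g $ i $ j \<in> ring_of_integers}"

definition K2 :: "('a::nonarch_local_field^2^2) set"
  where "K2 = {g \<in> integral_matrices. \<exists>h \<in> integral_matrices. g ** h = mat 1 \<and> h ** g = mat 1}"

definition B2 :: "('a::nonarch_local_field^2^2) set"
  where "B2 = {g \<in> GL2. g $ 2 $ 1 = 0}"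

text \<open>
  The modular character is normalized so that \<open>b\<close> scales Haar measure on the unipotent radical
  under \<open>n \<mapsto> b n b\<^sup>-\<^sup>1\<close> by \<open>|a/d|\<close>, the convention of normalized induction from the left.
\<close>

definition modular_B2 :: "'a::nonarch_local_field^2^2 \<Rightarrow> real"
  where "modular_B2 b = absF (b $ 1 $ 1) / absF (b $ 2 $ 2)"

definition borel_char ::
    "('a::nonarch_local_field \<Rightarrow> complex) \<Rightarrow> ('a \<Rightarrow> complex) \<Rightarrow> 'a^2^2 \<Rightarrow> complex"
  where "borel_char \<xi>1 \<xi>2 b = \<xi>1 (b $ 1 $ 1) * \<xi>2 (b $ 2 $ 2)"

definition locally_constant_on :: "'b::topological_space set \<Rightarrow> ('b \<Rightarrow> 'c) \<Rightarrow> bool"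
  where "locally_constant_on S f \<longleftrightarrow>
    (\<forall>x\<in>S. \<exists>U. open U \<and> x \<in> U \<and> (\<forall>y \<in> U \<inter> S. f y = f x))"

text \<open>
  Functions on \<open>GL(2,F)\<close> are represented extensionally (\<^const>\<open>undefined\<close> on singular matrices),
  so that equality of elements of \<open>Ind \<xi>1 \<xi>2\<close> is equality on \<open>GL(2,F)\<close>.
\<close>

definition Ind ::
    "('a::nonarch_local_field \<Rightarrow> complex) \<Rightarrow> ('a \<Rightarrow> complex) \<Rightarrow> ('a^2^2 \<Rightarrow> complex) set"
  where "Ind \<xi>1 \<xi>2 = {f \<in> extensional GL2. locally_constant_on GL2 f \<and>
    (\<forall>b\<in>B2. \<forall>g\<in>GL2.
       f (b ** g) = borel_char \<xi>1 \<xi>2 b * complex_of_real (modular_B2 b powr (1/2)) * f g)}"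

definition right_transl ::
    "'a::nonarch_local_field^2^2 \<Rightarrow> ('a^2^2 \<Rightarrow> complex) \<Rightarrow> 'a^2^2 \<Rightarrow> complex"
  where "right_transl g f = (\<lambda>x\<in>GL2. f (x ** g))"

definition spherical_vector ::
    "('a::nonarch_local_field \<Rightarrow> complex) \<Rightarrow> ('a \<Rightarrow> complex) \<Rightarrow> 'a^2^2 \<Rightarrow> complex"
  where "spherical_vector \<xi>1 \<xi>2 =
    (THE f. f \<in> Ind \<xi>1 \<xi>2 \<and> (\<forall>\<kappa>\<in>K2. right_transl \<kappa> f = f) \<and> f (mat 1) = 1)"


section \<open>The functional \<open>W\<close> and the function \<open>Wa\<close>\<close>

definition W_integrand ::
    "('a::nonarch_local_field \<Rightarrow> complex) \<Rightarrow> ('a^2^2 \<Rightarrow> complex) \<Rightarrow> 'a \<Rightarrow> complex"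
  where "W_integrand \<sigma> f a =
    f (mat2 0 1 1 0 ** mat2 1 1 0 1 ** mat2 a 0 0 1) * inverse (\<sigma> a)"

definition W_functional ::
    "'a::nonarch_local_field measure \<Rightarrow> ('a \<Rightarrow> complex) \<Rightarrow> ('a^2^2 \<Rightarrow> complex) \<Rightarrow> complex"
  where "W_functional \<mu> \<sigma> f = (LINT a|\<mu>. W_integrand \<sigma> f a)"

definition Wa ::
    "'a::nonarch_local_field measure \<Rightarrow> ('a \<Rightarrow> complex) \<Rightarrow> ('a \<Rightarrow> complex) \<Rightarrow> ('a \<Rightarrow> complex)
      \<Rightarrow> 'a^2^2 \<Rightarrow> complex"
  where "Wa \<mu> \<xi>1 \<xi>2 \<sigma> g = W_functional \<mu> \<sigma> (right_transl g (spherical_vector \<xi>1 \<xi>2))"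

definition eta :: "'a::nonarch_local_field \<Rightarrow> nat \<Rightarrow> 'a^2^2"
  where "eta \<pi> k = mat2 1 1 0 1 ** mat2 (\<pi> ^ k) 0 0 1"

definition Wnorm ::
    "'a::nonarch_local_field measure \<Rightarrow> 'a \<Rightarrow> ('a \<Rightarrow> complex) \<Rightarrow> ('a \<Rightarrow> complex)
      \<Rightarrow> ('a \<Rightarrow> complex) \<Rightarrow> 'a^2^2 \<Rightarrow> complex"
  where "Wnorm \<mu> \<pi> \<xi>1 \<xi>2 \<sigma> g =
    (let q = real (card (residue_field :: 'a set set));
         r = complex_of_real (q powr (-1/2));
         \<gamma>1 = \<xi>1 \<pi>; \<gamma>2 = \<xi>2 \<pi>; \<tau> = \<sigma> \<pi>
     in (1 - \<gamma>1 * inverse \<tau> * r) * (1 - inverse \<gamma>2 * \<tau> * r)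
          / (1 - \<gamma>1 * inverse \<gamma>2 * complex_of_real (inverse q)) * Wa \<mu> \<xi>1 \<xi>2 \<sigma> g)"

definition explicit_value :: "real \<Rightarrow> nat \<Rightarrow> complex \<Rightarrow> complex \<Rightarrow> complex \<Rightarrow> complex"
  where "explicit_value q k \<gamma>1 \<gamma>2 \<tau> =
    (let r = complex_of_real (q powr (-1/2))
     in inverse (1 - complex_of_real (inverse q)) * complex_of_real (q powr (- real k / 2)) *
        (\<gamma>1 ^ k * ((1 - \<gamma>2 * inverse \<tau> * r) * (1 - inverse \<gamma>1 * \<tau> * r) / (1 - inverse \<gamma>1 * \<gamma>2))
       + \<gamma>2 ^ k * ((1 - \<gamma>1 * inverse \<tau> * r) * (1 - inverse \<gamma>2 * \<tau> * r) / (1 - \<gamma>1 * inverse \<gamma>2))))"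


section \<open>Holomorphic functions of three variables\<close>

text \<open>For open \<open>S\<close>: the real Frechet derivative exists and is complex linear at each point.\<close>

definition holomorphic3_on ::
    "(complex \<times> complex \<times> complex \<Rightarrow> complex) \<Rightarrow> (complex \<times> complex \<times> complex) set \<Rightarrow> bool"
  where "holomorphic3_on f S \<longleftrightarrow>
    (\<forall>z\<in>S. \<exists>a b c. (f has_derivative (\<lambda>(u, v, w). a * u + b * v + c * w)) (at z))"

definition Cstar3 :: "(complex \<times> complex \<times> complex) set"
  where "Cstar3 = (- {0}) \<times> (- {0}) \<times> (- {0})"

definition unramified_in_range ::
    "'a::nonarch_local_field \<Rightarrow> ('a \<Rightarrow> complex) \<Rightarrow> ('a \<Rightarrow> complex) \<Rightarrow> ('a \<Rightarrow> complex) \<Rightarrow> bool"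
  where "unramified_in_range \<pi> \<xi>1 \<xi>2 \<sigma> \<longleftrightarrow>
    unramified_quasicharacter \<xi>1 \<and> unramified_quasicharacter \<xi>2 \<and> unramified_quasicharacter \<sigma> \<and>
    cmod (\<xi>1 \<pi> * inverse (\<sigma> \<pi>)) < real (card (residue_field :: 'a set set)) powr (1/2) \<and>
    cmod (inverse (\<xi>2 \<pi>) * \<sigma> \<pi>) < real (card (residue_field :: 'a set set)) powr (1/2)"

end

theory Submission
  imports Defs
begin

text \<open>
  The spherical vector depends only on \<open>|det g|\<close> and on the maximum norm of the bottom row of \<open>g\<close>.
  At \<open>\<eta>\<^sub>k\<close> that bottom row is \<open>(a\<pi>\<^sup>k, a + 1)\<close>, so with \<open>r = q\<^bsup>-1/2\<^esup>\<close>, \<open>x = \<gamma>\<^sub>1\<tau>\<^sup>-\<^sup>1r\<close>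
  and \<open>y = \<gamma>\<^sub>2\<^sup>-\<^sup>1\<tau>r\<close> the shells \<open>|a| < 1\<close> and \<open>|a| > 1\<close> contribute geometric series in \<open>x\<close> and \<open>y\<close>,
  and the units contribute a finite sum weighted by the volumes \<open>q\<^sup>-\<^sup>i/(1 - q\<^sup>-\<^sup>1)\<close> of the sets \<open>|a + 1| \<le> q\<^sup>-\<^sup>i\<close>.
  Since \<open>xy = \<gamma>\<^sub>1\<gamma>\<^sub>2\<^sup>-\<^sup>1q\<^sup>-\<^sup>1\<close>, the normalizing factor cancels every denominator depending on
  \<open>x\<close> and \<open>y\<close>. The general case follows because \<open>GL(2,F)\<close> is the union of the double cosets
  \<open>T \<eta>\<^sub>k K\<close>, \<open>T\<close> the diagonal torus, and left translation by \<open>T\<close> becomes a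
  translation of \<open>a\<close>, which only produces a monomial in the parameters, symmetric in \<open>\<gamma>\<^sub>1\<close> and \<open>\<gamma>\<^sub>2\<close>.
\<close>

section \<open>The absolute value\<close>

lemma absF_nonneg [simp]: "absF (x::'a::nonarch_local_field) \<ge> 0"
  using dist_absF[of x 0] zero_le_dist[of x 0] by simp

lemma absF_eq_0_iff [simp]: "absF (x::'a::nonarch_local_field) = 0 \<longleftrightarrow> x = 0"
  using dist_absF[of x 0] dist_eq_0_iff[of x 0] by simp

lemma absF_le_0_iff [simp]: "absF (x::'a::nonarch_local_field) \<le> 0 \<longleftrightarrow> x = 0"
  using absF_nonneg[of x] absF_eq_0_iff[of x] by linarith

lemma absF_pos_iff [simp]: "absF (x::'a::nonarch_local_field) > 0 \<longleftrightarrow> x \<noteq> 0"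
  using absF_nonneg[of x] absF_eq_0_iff[of x] by linarith

lemma absF_0 [simp]: "absF (0::'a::nonarch_local_field) = 0"
  by simp

lemma absF_1 [simp]: "absF (1::'a::nonarch_local_field) = 1"
  using absF_mult[of "1::'a" 1] absF_eq_0_iff[of "1::'a"] by simp

lemma absF_minus [simp]: "absF (- x) = absF (x::'a::nonarch_local_field)"
  by (metis dist_absF dist_commute diff_0 diff_0_right)

lemma absF_power [simp]: "absF (x ^ n) = absF (x::'a::nonarch_local_field) ^ n"
  by (induction n) (auto simp: absF_mult)

lemma absF_inverse [simp]: "absF (inverse x) = inverse (absF (x::'a::nonarch_local_field))"
proof (cases "x = 0")
  case False
  have "absF x * absF (inverse x) = 1"
    using False by (simp flip: absF_mult)
  then show ?thesis
    by (metis inverse_unique)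
qed simp

lemma absF_divide: "absF (x / y) = absF x / absF (y::'a::nonarch_local_field)"
  by (simp add: divide_inverse absF_mult)

lemma absF_power_int [simp]: "absF (x powi n) = absF (x::'a::nonarch_local_field) powi n"
  by (simp add: power_int_def)

lemma absF_minus_commute: "absF (x - y) = absF (y - x :: 'a::nonarch_local_field)"
  by (metis absF_minus minus_diff_eq)

lemma absF_add_le: "absF x \<le> c \<Longrightarrow> absF y \<le> c \<Longrightarrow> absF (x + y :: 'a::nonarch_local_field) \<le> c"
  using absF_ultrametric[of x y] by linarith

lemma absF_diff_le: "absF x \<le> c \<Longrightarrow> absF y \<le> c \<Longrightarrow> absF (x - y :: 'a::nonarch_local_field) \<le> c"
  using absF_ultrametric[of x "-y"] by simp

lemma absF_diff_less: "absF x < c \<Longrightarrow> absF y < c \<Longrightarrow> absF (x - y :: 'a::nonarch_local_field) < c"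
  using absF_ultrametric[of x "-y"] by simp

lemma absF_add_eq: 
  assumes "absF x < absF (y::'a::nonarch_local_field)"
  shows "absF (x + y) = absF y"
proof (rule antisym)
  show "absF (x + y) \<le> absF y"
    using assms absF_ultrametric[of x y] by simp
  show "absF y \<le> absF (x + y)"
    using assms absF_ultrametric[of "x + y" "-x"] by simp
qed

section \<open>Uniformizers and discreteness of the value group\<close>

lemma uniformizer_nonzero: "uniformizer p \<Longrightarrow> p \<noteq> 0"
  by (simp add: uniformizer_def)

text \<open>The maximal ideal consists of the integral multiples of \<open>p\<close>, so no absolute
  value lies strictly between \<open>absF p\<close> and 1. This makes strict and weak bounds
  interchangeable.\<close>

lemma uniformizer_dvd:
  fixes p x :: "'a::nonarch_local_field"
  assumes "uniformizer p"
  shows "absF x < 1 \<longleftrightarrow> absF x \<le> absF p"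
proof -
  have p: "p \<noteq> 0" "{x. absF x < 1} = (*) p ` {x. absF x \<le> 1}"
    using assms by (auto simp: uniformizer_def ring_of_integers_def)
  have "p * 1 \<in> {x. absF x < 1}"
    unfolding p(2) by (intro imageI) simp
  then have "absF p < 1" by simp
  moreover have "absF x \<le> absF p" if "absF x < 1"
  proof -
    have "x \<in> (*) p ` {x. absF x \<le> 1}"
      using that p(2) by blast
    then obtain y where "absF y \<le> 1" "x = p * y" by blast
    then show ?thesis
      by (simp add: absF_mult mult_left_le)
  qed
  ultimately show ?thesis by force
qed

lemma uniformizer_less_1: "uniformizer p \<Longrightarrow> absF (p::'a::nonarch_local_field) < 1"
  using uniformizer_dvd[of p p] by simp

lemma finite_residue_field: "finite (residue_field :: 'a::nonarch_local_field set set)"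
  using finite_residue[where 'a='a] by (simp add: residue_field_def ring_of_integers_def)

text \<open>The class axioms normalize a single uniformizer. Two uniformizers bound each other by
  \<open>uniformizer_dvd\<close>, so they have the same absolute value.\<close>

lemma absF_uniformizer:
  fixes p :: "'a::nonarch_local_field"
  assumes "uniformizer p"
  shows "absF p = 1 / real (card (residue_field :: 'a::nonarch_local_field set set))"
proof -
  obtain p' :: 'a where p': "p' \<noteq> 0" "{x. absF x < 1} = (*) p' ` {x. absF x \<le> 1}"
    "absF p' = 1 / real (card ({x::'a. absF x \<le> 1} //
      {(x, y). absF x \<le> 1 \<and> absF y \<le> 1 \<and> absF (x - y) < 1}))"
    using ex_uniformizer by blast
  have u: "uniformizer p'"
    using p' by (simp add: uniformizer_def ring_of_integers_def)
  have "absF p = absF p'"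
    using uniformizer_dvd[OF assms, of p'] uniformizer_dvd[OF u, of p]
      uniformizer_less_1[OF u] uniformizer_less_1[OF assms] by simp
  with p'(3) show ?thesis
    by (simp add: residue_field_def ring_of_integers_def)
qed

text \<open>Rounding the real logarithm down and dividing by \<open>p powi j\<close> moves the
  absolute value above \<open>absF p\<close> but not above 1, where discreteness leaves only
  1.\<close>

lemma absF_eq_powi:
  fixes p x :: "'a::nonarch_local_field"
  assumes "uniformizer p" "x \<noteq> 0"
  obtains j where "absF x = absF p powi j"
proof -
  define Q where "Q = absF p"
  have Q: "0 < Q" "Q < 1"
    using uniformizer_less_1 uniformizer_nonzero assms by (auto simp: Q_def)
  define j where "j = \<lfloor>log Q (absF x)\<rfloor>"
  have x: "absF x = Q powr (log Q (absF x))"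
    using Q assms by simp
  have "real_of_int j \<le> log Q (absF x)" "log Q (absF x) < real_of_int j + 1"
    unfolding j_def by linarith+
  \<comment> \<open>The base \<open>Q\<close> is below 1, so inequalities between exponents reverse:
    the floor yields the upper bound.\<close>
  then have "absF x \<le> Q powr (real_of_int j)" "Q powr (real_of_int j + 1) < absF x"
    using Q by (subst x; simp add: powr_less_mono' powr_mono')+
  then have *: "absF x \<le> Q powi j" "Q powi j * Q < absF x"
    using Q by (simp_all add: powr_real_of_int' powr_add)
  have "absF (x / p powi j) \<le> 1" "\<not> absF (x / p powi j) \<le> Q"
    using * Q by (auto simp: absF_divide field_simps simp flip: Q_def)
  then have "absF (x / p powi j) = 1"
    using uniformizer_dvd[OF assms(1), of "x / p powi j"] by (simp add: Q_def)
  then have "absF x = absF p powi j"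
    by (simp add: absF_divide field_simps split: if_splits)
  then show ?thesis by (rule that)
qed

section \<open>Unramified characters as functions of the absolute value\<close>

lemma unramified_cong:
  assumes "unramified_quasicharacter \<omega>" "absF x = absF y" "x \<noteq> 0"
  shows "\<omega> x = \<omega> y"
proof -
  have y: "y \<noteq> 0"
    using assms by (metis absF_eq_0_iff)
  have "absF (x / y) = 1"
    using assms y by (simp add: absF_divide)
  then have "\<omega> (x / y * y) = \<omega> y"
    using assms y unfolding unramified_quasicharacter_def
    by (metis absF_eq_0_iff mult_cancel_right1 zero_neq_one)
  then show ?thesis using y by simp
qed

lemma unramified_mult:
  "unramified_quasicharacter \<omega> \<Longrightarrow> x \<noteq> 0 \<Longrightarrow> y \<noteq> 0 \<Longrightarrow> \<omega> (x * y) = \<omega> x * \<omega> y"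
  by (simp add: unramified_quasicharacter_def)

lemma unramified_nonzero: "unramified_quasicharacter \<omega> \<Longrightarrow> x \<noteq> 0 \<Longrightarrow> \<omega> x \<noteq> 0"
  by (simp add: unramified_quasicharacter_def)

lemma unramified_1: "unramified_quasicharacter \<omega> \<Longrightarrow> \<omega> 1 = 1"
  by (simp add: unramified_quasicharacter_def)

lemma unramified_inverse:
  assumes "unramified_quasicharacter \<omega>" "x \<noteq> 0"
  shows "\<omega> (inverse x) = inverse (\<omega> x)"
proof -
  have "\<omega> x * \<omega> (inverse x) = 1"
    using assms unramified_1[OF assms(1)] by (simp flip: unramified_mult)
  then show ?thesis by (metis inverse_unique)
qed

lemma unramified_power:
  assumes "unramified_quasicharacter \<omega>" "x \<noteq> 0"
  shows "\<omega> (x ^ n) = \<omega> x ^ n"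
  by (induction n) (use assms in \<open>auto simp: unramified_1 unramified_mult\<close>)

lemma unramified_eq_powi:
  assumes "unramified_quasicharacter \<omega>" "p \<noteq> 0" "absF x = absF p powi j"
  shows "\<omega> x = \<omega> p powi j"
proof -
  have "\<omega> x = \<omega> (p powi j)"
    using assms by (intro unramified_cong) (auto simp flip: absF_eq_0_iff)
  also have "\<dots> = \<omega> p powi j"
    using assms by (auto simp: power_int_def unramified_power unramified_inverse)
  finally show ?thesis .
qed

section \<open>The spherical vector\<close>

lemma mat2_nth [simp]:
  "mat2 a b c d $ 1 $ 1 = a" "mat2 a b c d $ 1 $ 2 = b"
  "mat2 a b c d $ 2 $ 1 = c" "mat2 a b c d $ 2 $ 2 = d"
  by (simp_all add: mat2_def)

lemma matrix_mult_nth_2: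
  fixes A B :: "'a::semiring_1^2^2"
  shows "(A ** B) $ i $ j = A $ i $ 1 * B $ 1 $ j + A $ i $ 2 * B $ 2 $ j"
  by (simp add: matrix_matrix_mult_def sum_2)

lemma mat2_eqI:
  assumes "A $ 1 $ 1 = B $ 1 $ 1" "A $ 1 $ 2 = B $ 1 $ 2" "A $ 2 $ 1 = B $ 2 $ 1" "A $ 2 $ 2 = B $ 2 $ 2"
  shows "A = (B :: 'a^2^2)"
  using assms by (simp add: vec_eq_iff forall_2)

lemma det_mat2 [simp]: "det (mat2 a b c d) = a * d - b * (c::'a::field)"
  by (simp add: det_2)

lemma GL2_iff: "g \<in> GL2 \<longleftrightarrow> det g \<noteq> 0"
  by (simp add: GL2_def invertible_det_nz)

lemma GL2_mult: "g \<in> GL2 \<Longrightarrow> h \<in> GL2 \<Longrightarrow> g ** h \<in> GL2"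
  by (simp add: GL2_iff det_mul)

lemma integral_det: 
  assumes "g \<in> integral_matrices"
  shows "absF (det g) \<le> 1"
proof -
  have "absF (g $ i $ j) \<le> 1" for i j
    using assms by (auto simp: integral_matrices_def ring_of_integers_def)
  then show ?thesis
    unfolding det_2 by (intro absF_diff_le) (simp_all add: absF_mult mult_le_one)
qed

lemma absF_det_K2:
  assumes "g \<in> K2"
  shows "absF (det g) = 1"
proof -
  obtain h where h: "h \<in> integral_matrices" "g ** h = mat 1" and g: "g \<in> integral_matrices"
    using assms by (auto simp: K2_def)
  have "absF (det g) * absF (det h) = absF (det (g ** h))"
    by (simp add: det_mul absF_mult)
  also have "\<dots> = 1" by (simp add: h)
  finally show ?thesis
    using integral_det[OF g] integral_det[OF h(1)]
    by (metis absF_nonneg antisym mult.right_neutral mult_left_mono)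
qed

lemma K2_subset_GL2: "g \<in> K2 \<Longrightarrow> g \<in> GL2"
  using absF_det_K2[of g] by (auto simp: GL2_iff)

lemma mat2_in_K2:
  assumes "absF a \<le> 1" "absF b \<le> 1" "absF c \<le> 1" "absF d \<le> 1" "absF (a * d - b * c) = 1"
  shows "mat2 a b c d \<in> K2"
proof -
  define D where "D = a * d - b * c"
  have D: "D \<noteq> 0" "absF D = 1" using assms by (auto simp: D_def)
  let ?h = "mat2 (d / D) (- b / D) (- c / D) (a / D)"
  have "mat2 a b c d \<in> integral_matrices" "?h \<in> integral_matrices"
    using assms D by (auto simp: integral_matrices_def ring_of_integers_def forall_2 absF_divide)
  moreover have "mat2 a b c d ** ?h = mat 1" "?h ** mat2 a b c d = mat 1"
    using D by (auto intro!: mat2_eqI simp: matrix_mult_nth_2 mat_def field_simps)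
      (auto simp: D_def field_simps)
  ultimately show ?thesis by (auto simp: K2_def)
qed

section \<open>The bottom row norm and an explicit spherical function\<close>

definition bottom_norm :: "'a::nonarch_local_field^2^2 \<Rightarrow> real"
  where "bottom_norm g = max (absF (g $ 2 $ 1)) (absF (g $ 2 $ 2))"

text \<open>Characters are evaluated at field elements, so an entry attaining
  \<open>bottom_norm\<close> is singled out. For unramified characters any element of that absolute
  value would do.\<close>

definition bottom_gen :: "'a::nonarch_local_field^2^2 \<Rightarrow> 'a"
  where "bottom_gen g = (if absF (g $ 2 $ 1) \<le> absF (g $ 2 $ 2) then g $ 2 $ 2 else g $ 2 $ 1)"

lemma absF_bottom_gen: "absF (bottom_gen g) = bottom_norm g"
  by (simp add: bottom_gen_def bottom_norm_def)

lemma bottom_gen_nonzero: "g \<in> GL2 \<Longrightarrow> bottom_gen g \<noteq> 0"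
  by (auto simp: bottom_gen_def GL2_iff det_2)

lemma bottom_norm_pos: "g \<in> GL2 \<Longrightarrow> bottom_norm g > 0"
  using bottom_gen_nonzero[of g] by (simp flip: absF_bottom_gen)

lemma bottom_norm_mult_integral:
  assumes "h \<in> integral_matrices"
  shows "bottom_norm (g ** h) \<le> bottom_norm g"
proof -
  have "absF (g $ 2 $ i * h $ i $ j) \<le> bottom_norm g" for i j
  proof -
    have "absF (g $ 2 $ i) \<le> bottom_norm g"
      using exhaust_2[of i] by (auto simp: bottom_norm_def)
    moreover have "absF (h $ i $ j) \<le> 1"
      using assms by (auto simp: integral_matrices_def ring_of_integers_def)
    ultimately show ?thesis
      by (metis absF_mult absF_nonneg mult_left_le order_trans)
  qed
  then have "absF ((g ** h) $ 2 $ j) \<le> bottom_norm g" for j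
    unfolding matrix_mult_nth_2 by (intro absF_add_le)
  then show ?thesis by (simp add: bottom_norm_def[of "g ** h"])
qed

text \<open>The inequality for integral matrices applies both to \<open>h\<close> and to its
  integral inverse.\<close>

lemma bottom_norm_mult_K2:
  assumes "h \<in> K2"
  shows "bottom_norm (g ** h) = bottom_norm g"
proof -
  obtain h' where h': "h' \<in> integral_matrices" "h ** h' = mat 1" "h \<in> integral_matrices"
    using assms by (auto simp: K2_def)
  have "bottom_norm (g ** h ** h') \<le> bottom_norm (g ** h)"
    by (intro bottom_norm_mult_integral h')
  then show ?thesis
    using bottom_norm_mult_integral[OF h'(3), of g] h'
    by (simp flip: matrix_mul_assoc)
qed

text \<open>If \<open>g = b ** h\<close> with \<open>b\<close> in \<open>B2\<close> and
  \<open>h\<close> in \<open>K2\<close>, the bottom row of \<open>g\<close> is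
  \<open>b $ 2 $ 2\<close> times a row of norm 1. Hence the lower diagonal entry of \<open>b\<close>
  has absolute value \<open>bottom_norm g\<close>, the upper one has
  \<open>absF (det g) / bottom_norm g\<close>, and the formula is the inducing character times the
  square root of the modular character at \<open>b\<close>.\<close>

definition spherical_fun ::
    "('a::nonarch_local_field \<Rightarrow> complex) \<Rightarrow> ('a \<Rightarrow> complex) \<Rightarrow> 'a^2^2 \<Rightarrow> complex"
  where "spherical_fun \<xi>1 \<xi>2 = (\<lambda>g\<in>GL2. \<xi>1 (det g / bottom_gen g) * \<xi>2 (bottom_gen g) *
    complex_of_real ((absF (det g) / (bottom_norm g)\<^sup>2) powr (1/2)))"

lemma spherical_fun_cong:
  assumes "unramified_quasicharacter \<xi>1" "unramified_quasicharacter \<xi>2"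
    and "g \<in> GL2" "absF (det h) = absF (det g)" "bottom_norm h = bottom_norm g"
  shows "spherical_fun \<xi>1 \<xi>2 h = spherical_fun \<xi>1 \<xi>2 g"
proof -
  have h: "h \<in> GL2"
    using assms by (auto simp: GL2_iff simp flip: absF_eq_0_iff)
  have "\<xi>1 (det h / bottom_gen h) = \<xi>1 (det g / bottom_gen g)"
    using assms h bottom_gen_nonzero[OF h]
    by (intro unramified_cong) (auto simp: absF_divide absF_bottom_gen GL2_iff)
  moreover have "\<xi>2 (bottom_gen h) = \<xi>2 (bottom_gen g)"
    using assms bottom_gen_nonzero[OF h]
    by (intro unramified_cong) (auto simp: absF_bottom_gen)
  ultimately show ?thesis
    using assms h by (simp add: spherical_fun_def)
qed

lemma spherical_fun_mult_K2:
  assumes "unramified_quasicharacter \<xi>1" "unramified_quasicharacter \<xi>2" "g \<in> GL2" "h \<in> K2"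
  shows "spherical_fun \<xi>1 \<xi>2 (g ** h) = spherical_fun \<xi>1 \<xi>2 g"
  using assms
  by (intro spherical_fun_cong) (auto simp: det_mul absF_mult absF_det_K2 bottom_norm_mult_K2)

lemma spherical_fun_mult_B2:
  assumes "unramified_quasicharacter \<xi>1" "unramified_quasicharacter \<xi>2" "g \<in> GL2" "b \<in> B2"
  shows "spherical_fun \<xi>1 \<xi>2 (b ** g) =
    borel_char \<xi>1 \<xi>2 b * complex_of_real (modular_B2 b powr (1/2)) * spherical_fun \<xi>1 \<xi>2 g"
proof -
  have b: "b \<in> GL2" "b $ 2 $ 1 = 0" using assms by (auto simp: B2_def)
  then have b': "b $ 1 $ 1 \<noteq> 0" "b $ 2 $ 2 \<noteq> 0" "det b = b $ 1 $ 1 * b $ 2 $ 2"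
    by (auto simp: GL2_iff det_2)
  have bg: "b ** g \<in> GL2" using b assms GL2_mult by blast
  \<comment> \<open>Both bottom entries are multiplied by the same nonzero factor, so the comparison
    that selects one of them has the same outcome. The generator therefore scales exactly, not only
    up to a unit.\<close>
  have gen: "bottom_gen (b ** g) = b $ 2 $ 2 * bottom_gen g"
    using b b' by (auto simp: bottom_gen_def matrix_mult_nth_2 absF_mult)
  have norm: "bottom_norm (b ** g) = absF (b $ 2 $ 2) * bottom_norm g"
    by (simp add: absF_mult gen flip: absF_bottom_gen)
  have nz: "bottom_gen g \<noteq> 0" "bottom_norm g > 0" "det g \<noteq> 0"
    using bottom_gen_nonzero bottom_norm_pos assms(3) by (auto simp: GL2_iff)
  have "\<xi>1 (det (b ** g) / bottom_gen (b ** g)) = \<xi>1 (b $ 1 $ 1 * (det g / bottom_gen g))"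
    using b' nz by (simp add: gen det_mul)
  also have "\<dots> = \<xi>1 (b $ 1 $ 1) * \<xi>1 (det g / bottom_gen g)"
    using b' nz assms by (intro unramified_mult) auto
  finally have 1: "\<xi>1 (det (b ** g) / bottom_gen (b ** g)) =
    \<xi>1 (b $ 1 $ 1) * \<xi>1 (det g / bottom_gen g)" .
  have 2: "\<xi>2 (bottom_gen (b ** g)) = \<xi>2 (b $ 2 $ 2) * \<xi>2 (bottom_gen g)"
    using b' nz assms by (simp add: gen unramified_mult)
  have "absF (det (b ** g)) / (bottom_norm (b ** g))\<^sup>2 =
    modular_B2 b * (absF (det g) / (bottom_norm g)\<^sup>2)"
    using b' nz by (simp add: det_mul absF_mult norm modular_B2_def power2_eq_square field_simps)
  then have 3: "(absF (det (b ** g)) / (bottom_norm (b ** g))\<^sup>2) powr (1/2) =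
    modular_B2 b powr (1/2) * (absF (det g) / (bottom_norm g)\<^sup>2) powr (1/2)"
    by (simp only:) (rule powr_mult; simp add: modular_B2_def)
  show ?thesis
    using bg assms(3) by (simp add: spherical_fun_def 1 2 3 borel_char_def)
qed

section \<open>Local constancy of the spherical function\<close>

lemma open_entries: "open {y::'a::metric_space^2^2. \<forall>i j. dist (y $ i $ j) (x $ i $ j) < e}"
proof -
  have "{y::'a^2^2. \<forall>i j. dist (y $ i $ j) (x $ i $ j) < e} =
      (\<Inter>i. \<Inter>j. {y. dist (y $ i $ j) (x $ i $ j) < e})" by auto
  also have "open \<dots>"
    by (intro open_INT finite_class.finite_UNIV ballI open_Collect_less continuous_intros)
  finally show ?thesis .
qed

text \<open>The difference splits as \<open>(a' - a) * b' - (b - b') * a\<close>, and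
  \<open>e \<le> M\<close> keeps \<open>b'\<close> within the bound \<open>M\<close>.\<close>

lemma absF_mult_diff_less:
  assumes "absF (a' - a) < e" "absF (b' - b) < e" "absF a \<le> M" "absF b \<le> M" "e \<le> M"
  shows "absF (a' * b' - a * b :: 'a::nonarch_local_field) < e * M"
proof -
  have e: "e > 0" using assms(1) absF_nonneg[of "a' - a"] by linarith
  have "absF (b' - b + b) \<le> M"
    using assms by (intro absF_add_le) auto
  then have b': "absF b' \<le> M" by simp
  have less: "u * v < e * M" if "0 \<le> u" "u < e" "v \<le> M" for u v
    using that e assms(5) mult_left_mono[of v M u] mult_strict_right_mono[of u e M] by linarith
  have "absF (a' * b' - a * b) = absF ((a' - a) * b' - (b - b') * a)"
    by (simp add: algebra_simps)
  also have "\<dots> < e * M"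
    using assms b' absF_minus_commute[of b b'] by (intro absF_diff_less) (simp_all add: absF_mult less)
  finally show ?thesis .
qed

text \<open>An entry attaining the maximum keeps its absolute value under a smaller perturbation,
  and the other entry cannot rise above the maximum.\<close>

lemma max_absF_cong:
  fixes c d c' d' :: "'a::nonarch_local_field"
  assumes "absF (c' - c) < max (absF c) (absF d)" "absF (d' - d) < max (absF c) (absF d)"
  shows "max (absF c') (absF d') = max (absF c) (absF d)"
proof -
  have le: "absF x' \<le> m" if "absF (x' - x) < m" "absF x \<le> m" for x x' :: 'a and m
    using absF_add_le[of "x' - x" m x] that by simp
  have eq: "absF x' = m" if "absF (x' - x) < m" "absF x = m" for x x' :: 'a and m
    using absF_add_eq[of "x' - x" x] that by simp
  show ?thesis
    using assms le[of c' c "max (absF c) (absF d)"] le[of d' d "max (absF c) (absF d)"]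
      eq[of c' c "max (absF c) (absF d)"] eq[of d' d "max (absF c) (absF d)"]
    by (smt (verit))
qed

lemma locally_constant_spherical_fun:
  assumes "unramified_quasicharacter \<xi>1" "unramified_quasicharacter \<xi>2"
  shows "locally_constant_on GL2 (spherical_fun \<xi>1 \<xi>2)"
  unfolding locally_constant_on_def
proof
  fix x :: "'a^2^2" assume x: "x \<in> GL2"
  then have d: "det x \<noteq> 0" by (simp add: GL2_iff)
  define M where "M = max (max (absF (x $ 1 $ 1)) (absF (x $ 1 $ 2))) (bottom_norm x)"
  \<comment> \<open>With this radius the error in the determinant is below \<open>e * M\<close>,
    which is \<open>absF (det x)\<close>. Expanding the determinant along the bottom row also gives
    \<open>e \<le> bottom_norm x\<close>, so neither quantity entering
    \<open>spherical_fun_cong\<close> changes.\<close>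
  define e where "e = absF (det x) / M"
  have M: "absF (x $ i $ j) \<le> M" for i j
    using exhaust_2[of i] exhaust_2[of j] by (auto simp: M_def bottom_norm_def)
  have M0: "M > 0" using bottom_norm_pos[OF x] by (simp add: M_def)
  have b: "absF (x $ 2 $ j) \<le> bottom_norm x" for j
    using exhaust_2[of j] by (auto simp: bottom_norm_def)
  have "absF (det x) \<le> M * bottom_norm x"
    unfolding det_2 by (intro absF_diff_le) (auto simp: absF_mult intro!: mult_mono M b less_imp_le[OF M0])
  then have e_le: "e \<le> bottom_norm x"
    using M0 by (simp add: e_def field_simps)
  then have eM: "e \<le> M" by (simp add: M_def)
  have e0: "e > 0" using M0 d by (simp add: e_def)
  let ?U = "{y::'a^2^2. \<forall>i j. dist (y $ i $ j) (x $ i $ j) < e}"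
  have "spherical_fun \<xi>1 \<xi>2 y = spherical_fun \<xi>1 \<xi>2 x" if "y \<in> ?U" for y
  proof (rule spherical_fun_cong[OF assms x])
    have y: "absF (y $ i $ j - x $ i $ j) < e" for i j
      using that by (simp add: dist_absF)
    have "absF (det y - det x) = absF ((y$1$1 * y$2$2 - x$1$1 * x$2$2) - (y$1$2 * y$2$1 - x$1$2 * x$2$1))"
      by (simp add: det_2 algebra_simps)
    also have "\<dots> < e * M"
      by (intro absF_diff_less absF_mult_diff_less y M eM)
    also have "\<dots> = absF (det x)" using M0 by (simp add: e_def)
    finally show "absF (det y) = absF (det x)"
      using absF_add_eq[of "det y - det x" "det x"] by simp
    show "bottom_norm y = bottom_norm x"
      unfolding bottom_norm_def
      using y[of 2 1] y[of 2 2] e_le by (intro max_absF_cong) (auto simp: bottom_norm_def)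
  qed
  moreover have "open ?U" by (rule open_entries)
  moreover have "x \<in> ?U" using e0 by simp
  ultimately show "\<exists>U. open U \<and> x \<in> U \<and> (\<forall>y\<in>U \<inter> GL2. spherical_fun \<xi>1 \<xi>2 y = spherical_fun \<xi>1 \<xi>2 x)"
    by blast
qed

text \<open>A column operation clears the lower left entry. The larger bottom entry is the pivot,
  which makes the multiplier integral; if the pivot stands on the left, the columns are exchanged as
  well.\<close>

lemma iwasawa:
  fixes g :: "'a::nonarch_local_field^2^2"
  assumes "g \<in> GL2"
  obtains h where "h \<in> K2" "g ** h \<in> B2"
proof (cases "absF (g $ 2 $ 1) \<le> absF (g $ 2 $ 2)")
  case True
  then have nz: "g $ 2 $ 2 \<noteq> 0"
    using assms by (auto simp: GL2_iff det_2)
  let ?h = "mat2 1 0 (- (g $ 2 $ 1) / g $ 2 $ 2) 1"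
  have h: "?h \<in> K2"
    using True nz by (intro mat2_in_K2) (auto simp: absF_divide)
  moreover have "g ** ?h \<in> B2"
    using nz GL2_mult[OF assms K2_subset_GL2[OF h]] by (auto simp: B2_def matrix_mult_nth_2)
  ultimately show ?thesis by (rule that)
next
  case False
  then have nz: "g $ 2 $ 1 \<noteq> 0" by auto
  let ?h = "mat2 (- (g $ 2 $ 2) / g $ 2 $ 1) 1 1 0"
  have h: "?h \<in> K2"
    using False nz by (intro mat2_in_K2) (auto simp: absF_divide)
  moreover have "g ** ?h \<in> B2"
    using nz GL2_mult[OF assms K2_subset_GL2[OF h]] by (auto simp: B2_def matrix_mult_nth_2)
  ultimately show ?thesis by (rule that)
qed

text \<open>The explicit function has the defining properties. Any competitor agrees with it: the
  value at the identity determines it on \<open>B2\<close>, and right \<open>K2\<close>-invariance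
  extends this to the whole group by the Iwasawa decomposition.\<close>

lemma spherical_vector_eq:
  fixes \<xi>1 \<xi>2 :: "'a::nonarch_local_field \<Rightarrow> complex"
  assumes "unramified_quasicharacter \<xi>1" "unramified_quasicharacter \<xi>2"
  shows "spherical_vector \<xi>1 \<xi>2 = spherical_fun \<xi>1 \<xi>2"
  unfolding spherical_vector_def
proof (rule the_equality, intro conjI ballI)
  have [simp]: "(mat 1 :: 'a^2^2) \<in> GL2" by (simp add: GL2_iff)
  show "spherical_fun \<xi>1 \<xi>2 \<in> Ind \<xi>1 \<xi>2"
    using assms spherical_fun_mult_B2 locally_constant_spherical_fun[OF assms]
    by (auto simp: Ind_def) (simp add: spherical_fun_def)
  show "right_transl \<kappa> (spherical_fun \<xi>1 \<xi>2) = spherical_fun \<xi>1 \<xi>2" if "\<kappa> \<in> K2" for \<kappa>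
  proof (rule extensionalityI[of _ GL2])
    show "right_transl \<kappa> (spherical_fun \<xi>1 \<xi>2) \<in> extensional GL2"
      "spherical_fun \<xi>1 \<xi>2 \<in> extensional GL2"
      by (auto simp: right_transl_def spherical_fun_def)
  qed (use assms that spherical_fun_mult_K2 in \<open>auto simp: right_transl_def\<close>)
  have "bottom_gen (mat 1 :: 'a^2^2) = 1" "bottom_norm (mat 1 :: 'a^2^2) = 1"
    by (auto simp: bottom_gen_def bottom_norm_def mat_def)
  then show "spherical_fun \<xi>1 \<xi>2 (mat 1) = 1"
    using assms by (simp add: spherical_fun_def unramified_1)
  fix f assume f: "f \<in> Ind \<xi>1 \<xi>2 \<and> (\<forall>\<kappa>\<in>K2. right_transl \<kappa> f = f) \<and> f (mat 1) = 1"
  show "f = spherical_fun \<xi>1 \<xi>2"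
  proof (rule extensionalityI[of _ GL2])
    show "f \<in> extensional GL2" "spherical_fun \<xi>1 \<xi>2 \<in> extensional GL2"
      using f by (auto simp: Ind_def spherical_fun_def)
    fix g :: "'a^2^2" assume g: "g \<in> GL2"
    obtain h where h: "h \<in> K2" "g ** h \<in> B2" using iwasawa[OF g] by blast
    have "f g = right_transl h f g" using f h by auto
    \<comment> \<open>The trivial factor \<open>mat 1\<close> lets the equivariance under
      \<open>B2\<close> act on the value at the identity.\<close>
    also have "\<dots> = f (g ** h ** mat 1)" using g by (simp add: right_transl_def)
    also have "\<dots> = borel_char \<xi>1 \<xi>2 (g ** h) * complex_of_real (modular_B2 (g ** h) powr (1/2)) * f (mat 1)"
      using f h unfolding Ind_def by (auto simp del: matrix_mul_rid)
    also have "\<dots> = borel_char \<xi>1 \<xi>2 (g ** h) * complex_of_real (modular_B2 (g ** h) powr (1/2)) *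
        spherical_fun \<xi>1 \<xi>2 (mat 1)"
      using f \<open>spherical_fun \<xi>1 \<xi>2 (mat 1) = 1\<close> by simp
    also have "\<dots> = spherical_fun \<xi>1 \<xi>2 (g ** h ** mat 1)"
      using assms h by (intro spherical_fun_mult_B2 [symmetric]) auto
    also have "\<dots> = spherical_fun \<xi>1 \<xi>2 g"
      using assms g h by (simp add: spherical_fun_mult_K2)
    finally show "f g = spherical_fun \<xi>1 \<xi>2 g" .
  qed
qed

section \<open>Volumes\<close>

text \<open>One element is chosen from each residue class. The set serves to cut a disk into disks
  of the next smaller radius and to count them.\<close>

lemma residue_representatives:
  obtains T :: "'a::nonarch_local_field set"
  where "finite T" "card T = card (residue_field :: 'a set set)" "\<And>t. t \<in> T \<Longrightarrow> absF t \<le> 1"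
    "\<And>x. absF x \<le> 1 \<Longrightarrow> \<exists>t\<in>T. absF (x - t) < 1"
    "\<And>s t. s \<in> T \<Longrightarrow> t \<in> T \<Longrightarrow> absF (s - t) < 1 \<Longrightarrow> s = t"
proof -
  define E where "E = {(x::'a, y). absF x \<le> 1 \<and> absF y \<le> 1 \<and> absF (x - y) < 1}"
  define R where "R = {x::'a. absF x \<le> 1} // E"
  have R: "R = residue_field"
    by (simp add: R_def E_def residue_field_def ring_of_integers_def)
  have E: "equiv {x. absF x \<le> 1} E"
  proof (rule equivI)
    show "E \<subseteq> {x. absF x \<le> 1} \<times> {x. absF x \<le> 1}" by (auto simp: E_def)
    show "refl_on {x. absF x \<le> 1} E" by (auto simp: refl_on_def E_def)
    show "sym E" by (auto simp: sym_def E_def absF_minus_commute)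
    have "absF (x - z) < 1" if "absF (x - y) < 1" "absF (y - z) < 1" for x y z :: 'a
      using absF_ultrametric[of "x - y" "y - z"] that by simp
    then show "trans E" by (auto simp: trans_def E_def)
  qed
  define s where "s X = (SOME x. x \<in> X)" for X :: "'a set"
  have s: "s X \<in> X" if "X \<in> R" for X
    using in_quotient_imp_non_empty[OF E] that unfolding R_def s_def by (metis some_in_eq)
  have s1: "absF (s X) \<le> 1" if "X \<in> R" for X
    using in_quotient_imp_subset[OF E] s that unfolding R_def by blast
  have eq: "X = Y" if "X \<in> R" "Y \<in> R" "absF (s X - s Y) < 1" for X Y
    using quotient_eq_iff[OF E, of X Y "s X" "s Y"] s s1 that by (auto simp: R_def E_def)
  show ?thesis
  proof (rule that[of "s ` R"])
    show "finite (s ` R)" using finite_residue_field[where 'a='a] by (simp add: R)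
    have "inj_on s R" using eq by (intro inj_onI) auto
    then show "card (s ` R) = card (residue_field :: 'a set set)" by (simp add: R card_image)
    show "\<exists>t\<in>s ` R. absF (x - t) < 1" if "absF x \<le> 1" for x
    proof
      have "E `` {x} \<in> R" using that by (auto simp: R_def intro: quotientI)
      then show "s (E `` {x}) \<in> s ` R" "absF (x - s (E `` {x})) < 1"
        using s by (auto simp: E_def)
    qed
  qed (use s1 eq in auto)
qed

section \<open>Scaling invariance of the multiplicative Haar measure\<close>

lemma mult_haar_sets_iff:
  assumes "mult_haar_measure \<mu>"
  shows "A \<in> sets \<mu> \<longleftrightarrow> A \<in> sets borel \<and> 0 \<notin> A"
  using assms sets_restrict_space_iff[of "- {0}" borel A]
  by (auto simp: mult_haar_measure_def)

lemma mult_haar_space: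
  assumes "mult_haar_measure \<mu>"
  shows "space \<mu> = - {0}"
  using assms sets_eq_imp_space_eq[of \<mu> "restrict_space borel (-{0})"]
  by (auto simp: mult_haar_measure_def space_restrict_space)

lemma mult_haar_measurable_times:
  fixes c :: "'a::nonarch_local_field"
  assumes "mult_haar_measure \<mu>" "c \<noteq> 0"
  shows "(*) c \<in> measurable \<mu> \<mu>"
proof -
  have "continuous_on UNIV ((*) c)"
    unfolding continuous_on_iff
  proof (intro ballI allI impI)
    fix x :: 'a and e :: real assume "e > 0"
    then show "\<exists>d>0. \<forall>x'\<in>UNIV. dist x' x < d \<longrightarrow> dist (c * x') (c * x) < e"
      using assms(2) by (intro exI[of _ "e / absF c"])
        (auto simp: dist_absF absF_mult pos_less_divide_eq mult.commute[of _ "absF c"] simp flip: right_diff_distrib)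
  qed
  then have "(*) c \<in> borel_measurable borel" by (rule borel_measurable_continuous_onI)
  then have "(*) c \<in> measurable (restrict_space borel (-{0})) (restrict_space borel (-{0}))"
    using assms(2) by (intro measurable_restrict_space3) auto
  moreover have "sets \<mu> = sets (restrict_space borel (-{0}))"
    using assms(1) by (simp add: mult_haar_measure_def)
  ultimately show ?thesis by (simp cong: measurable_cong_sets)
qed

text \<open>Invariance is given for images, and a preimage under multiplication by \<open>c\<close>
  is an image under multiplication by \<open>inverse c\<close>. The pushforward form is the one used
  to change variables in integrals.\<close>

lemma mult_haar_distr:
  fixes c :: "'a::nonarch_local_field"
  assumes "mult_haar_measure \<mu>" "c \<noteq> 0"
  shows "distr \<mu> \<mu> ((*) c) = \<mu>"
proof (rule measure_eqI)
  fix A assume "A \<in> sets (distr \<mu> \<mu> ((*) c))"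
  then have A: "A \<in> sets \<mu>" by simp
  then have "0 \<notin> A" using mult_haar_sets_iff[OF assms(1)] by blast
  then have "(*) c -` A \<inter> space \<mu> = (*) (inverse c) ` A"
    using assms by (auto simp: mult_haar_space image_iff field_simps intro!: bexI[of _ "c * _"])
  then show "emeasure (distr \<mu> \<mu> ((*) c)) A = emeasure \<mu> A"
    using assms A by (simp add: emeasure_distr mult_haar_measurable_times)
      (simp add: mult_haar_measure_def)
qed simp

lemma mult_haar_scale:
  fixes c :: "'a::nonarch_local_field"
  assumes "mult_haar_measure \<mu>" "c \<noteq> 0" "A \<in> sets \<mu>"
    and "\<And>a. a \<noteq> 0 \<Longrightarrow> a \<in> B \<longleftrightarrow> c * a \<in> A" "0 \<notin> B"
  shows "emeasure \<mu> B = emeasure \<mu> A"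
proof -
  have "emeasure \<mu> A = emeasure (distr \<mu> \<mu> ((*) c)) A"
    using assms by (simp add: mult_haar_distr)
  also have "\<dots> = emeasure \<mu> ((*) c -` A \<inter> space \<mu>)"
    using assms by (simp add: emeasure_distr mult_haar_measurable_times)
  also have "(*) c -` A \<inter> space \<mu> = B"
    using assms(4,5) by (auto simp: mult_haar_space[OF assms(1)]) metis
  finally show ?thesis ..
qed

lemma borel_absF_le: "{a. absF (a - c) \<le> s} \<in> sets (borel :: 'a::nonarch_local_field measure)"
proof -
  have "{a. absF (a - c) \<le> s} = cball c s"
    by (auto simp: dist_absF absF_minus_commute)
  then show ?thesis by simp
qed

lemma borel_absF_eq: "{a. absF a = s} \<in> sets (borel :: 'a::nonarch_local_field measure)"
proof -
  have "{a::'a. absF a = s} = {a. dist a 0 = s}"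
    by (simp add: dist_absF)
  then show ?thesis
    by (simp only:) (intro borel_closed closed_Collect_eq continuous_intros)
qed

lemma sets_shell:
  assumes "mult_haar_measure \<mu>" "s > 0"
  shows "{a. absF a = s} \<in> sets \<mu>"
  using assms borel_absF_eq by (auto simp: mult_haar_sets_iff)

lemma emeasure_shell:
  fixes p :: "'a::nonarch_local_field" and \<mu> :: "'a measure"
  assumes "mult_haar_measure \<mu>" "p \<noteq> 0"
  shows "emeasure \<mu> {a. absF a = absF p powi j} = 1"
proof -
  have "emeasure \<mu> {a. absF a = absF p powi j} = emeasure \<mu> {u. absF u = 1}"
    using assms by (intro mult_haar_scale[of \<mu> "inverse (p powi j)"] sets_shell)
      (auto simp: absF_mult, auto simp: field_simps)
  also have "\<dots> = 1" using assms(1) by (simp add: mult_haar_measure_def)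
  finally show ?thesis .
qed

section \<open>Volumes of disks inside the unit group\<close>

lemma absF_near_unit:
  assumes "absF (c::'a::nonarch_local_field) = 1" "absF (a - c) < 1"
  shows "absF a = 1"
  using absF_add_eq[of "a - c" c] assms by simp

lemma sets_disk:
  assumes "mult_haar_measure \<mu>" "absF c = 1" "s < 1"
  shows "{a. absF (a - c) \<le> s} \<in> sets \<mu>"
  using assms by (auto simp: mult_haar_sets_iff borel_absF_le)

lemma emeasure_disk_le_1:
  assumes "mult_haar_measure \<mu>" "absF c = 1" "s < 1"
  shows "emeasure \<mu> {a. absF (a - c) \<le> s} \<le> 1"
proof -
  have "emeasure \<mu> {a. absF (a - c) \<le> s} \<le> emeasure \<mu> {u. absF u = 1}"
    using assms by (intro emeasure_mono sets_shell) (auto intro: absF_near_unit)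
  also have "\<dots> = 1" using assms(1) by (simp add: mult_haar_measure_def)
  finally show ?thesis .
qed

text \<open>Division by the unit \<open>c\<close> carries the centre to 1 and preserves
  distances.\<close>

lemma emeasure_disk_eq:
  assumes "mult_haar_measure \<mu>" "absF c = 1" "s < 1"
  shows "emeasure \<mu> {a. absF (a - c) \<le> s} = emeasure \<mu> {a. absF (a - 1) \<le> s}"
proof (rule mult_haar_scale[of _ "inverse c"])
  have c: "c \<noteq> 0" using assms by auto
  then show "inverse c \<noteq> 0" by simp
  have "absF (inverse c * a - 1) = absF (a - c)" for a
  proof -
    have "inverse c * a - 1 = (a - c) / c" using c by (simp add: field_simps)
    then show ?thesis using assms by (simp add: absF_divide)
  qed
  then show "a \<in> {a. absF (a - c) \<le> s} \<longleftrightarrow> inverse c * a \<in> {a. absF (a - 1) \<le> s}" for a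
    by simp
qed (use assms sets_disk[of \<mu> 1 s] in auto)

text \<open>Two ultrametric disks of radius \<open>s\<close> with a common point have centres at
  distance at most \<open>s\<close>. Separated centres thus give disjoint disks, all of the same
  volume.\<close>

lemma measure_UN_disks:
  assumes "mult_haar_measure \<mu>" "s < 1" "finite T" "\<And>t. t \<in> T \<Longrightarrow> absF (c t) = 1"
    and disj: "\<And>t t'. t \<in> T \<Longrightarrow> t' \<in> T \<Longrightarrow> absF (c t - c t') \<le> s \<Longrightarrow> t = t'"
  shows "measure \<mu> (\<Union>t\<in>T. {a. absF (a - c t) \<le> s}) = real (card T) * measure \<mu> {a. absF (a - 1) \<le> s}"
proof -
  have "measure \<mu> (\<Union>t\<in>T. {a. absF (a - c t) \<le> s}) = (\<Sum>t\<in>T. measure \<mu> {a. absF (a - c t) \<le> s})"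
  proof (rule measure_finite_Union)
    show "disjoint_family_on (\<lambda>t. {a. absF (a - c t) \<le> s}) T"
    proof (unfold disjoint_family_on_def, intro ballI impI, rule ccontr)
      fix t t' assume t: "t \<in> T" "t' \<in> T" "t \<noteq> t'"
        "{a. absF (a - c t) \<le> s} \<inter> {a. absF (a - c t') \<le> s} \<noteq> {}"
      then obtain a where "absF (a - c t) \<le> s" "absF (a - c t') \<le> s" by blast
      then have "absF ((a - c t') - (a - c t)) \<le> s" using absF_diff_le by blast
      then show False using disj t by auto
    qed
    show "emeasure \<mu> {a. absF (a - c t) \<le> s} \<noteq> \<infinity>" if "t \<in> T" for t
    proof -
      have "emeasure \<mu> {a. absF (a - c t) \<le> s} \<le> 1"
        using assms that by (intro emeasure_disk_le_1) auto
      then show ?thesis by (auto simp: top_unique)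
    qed
  qed (use assms in \<open>auto intro: sets_disk\<close>)
  also have "\<dots> = (\<Sum>t\<in>T. measure \<mu> {a. absF (a - 1) \<le> s})"
    using emeasure_disk_eq[OF assms(1) assms(4) assms(2)] by (intro sum.cong) (simp_all add: measure_def)
  finally show ?thesis by simp
qed

text \<open>Let q be the inverse of \<open>absF p\<close>. The units have volume 1 and are a
  disjoint union of q - 1 disks of radius 1/q, which gives the volume 1/(q - 1). Each disk around 1
  splits into q disks of the next radius, so every further step divides the volume by q.\<close>

lemma measure_disk:
  fixes p :: "'a::nonarch_local_field" and \<mu> :: "'a measure"
  assumes "uniformizer p" "mult_haar_measure \<mu>"
  shows "measure \<mu> {a. absF (a - 1) \<le> absF p ^ Suc n} = absF p ^ Suc n / (1 - absF p)"
proof -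
  let ?Q = "absF p"
  have Q: "0 < ?Q" "?Q < 1" 
    using assms(1) by (simp_all add: uniformizer_nonzero uniformizer_less_1)
  obtain T :: "'a set" where T: "finite T" "card T = card (residue_field :: 'a set set)"
    "\<And>t. t \<in> T \<Longrightarrow> absF t \<le> 1"
    "\<And>x. absF x \<le> 1 \<Longrightarrow> \<exists>t\<in>T. absF (x - t) < 1"
    "\<And>s t. s \<in> T \<Longrightarrow> t \<in> T \<Longrightarrow> absF (s - t) < 1 \<Longrightarrow> s = t"
    using residue_representatives by blast
  have card: "real (card T) = 1 / ?Q"
    unfolding T(2) absF_uniformizer[OF assms(1)] by simp
  show ?thesis
  proof (induction n)
    case 0
    \<comment> \<open>\<open>z\<close> represents the zero residue class; every other representative
      is a unit.\<close>
    obtain z where z: "z \<in> T" "absF z < 1"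
      using T(4)[of 0] by auto
    have T1: "absF t = 1" if "t \<in> T - {z}" for t
    proof (rule ccontr)
      assume "absF t \<noteq> 1"
      then have "absF (t - z) < 1"
        using that T(3)[of t] z by (intro absF_diff_less) auto
      then show False using T(5) that z by auto
    qed
    have "{u. absF u = 1} = (\<Union>t\<in>T-{z}. {a. absF (a - t) \<le> ?Q})"
    proof (intro equalityI subsetI)
      fix u :: 'a assume u: "u \<in> {u. absF u = 1}"
      then obtain t where t: "t \<in> T" "absF (u - t) < 1" using T(4)[of u] by auto
      have "absF t = 1" using absF_near_unit[of u t] u t by (simp add: absF_minus_commute)
      then have "t \<noteq> z" using z by auto
      then show "u \<in> (\<Union>t\<in>T-{z}. {a. absF (a - t) \<le> ?Q})"
        using t uniformizer_dvd[OF assms(1)] by auto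
    qed (use T1 absF_near_unit uniformizer_dvd[OF assms(1)] in auto)
    moreover have "measure \<mu> (\<Union>t\<in>T-{z}. {a. absF (a - t) \<le> ?Q}) =
        real (card (T - {z})) * measure \<mu> {a. absF (a - 1) \<le> ?Q}"
      using assms(2) Q(2)
    proof (rule measure_UN_disks)
      show "t = t'" if "t \<in> T - {z}" "t' \<in> T - {z}" "absF (t - t') \<le> ?Q" for t t'
        using that T(5)[of t t'] uniformizer_dvd[OF assms(1), of "t - t'"] by blast
    qed (use T T1 in auto)
    moreover have "measure \<mu> {u. absF u = 1} = 1"
      using assms(2) by (simp add: mult_haar_measure_def measure_def)
    moreover have "real (card (T - {z})) = 1 / ?Q - 1"
      using z T(1) card card_gt_0_iff[of T] by (subst card_Diff_singleton) (auto simp: of_nat_diff Suc_le_eq)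
    ultimately have "1 = (1 / ?Q - 1) * measure \<mu> {a. absF (a - 1) \<le> ?Q}"
      by (simp del: of_nat_diff)
    then show ?case using Q by (simp add: field_simps)
  next
    case (Suc n)
    \<comment> \<open>A point within \<open>?Q ^ Suc n\<close> of 1 is
      \<open>1 + p ^ Suc n * x\<close> with \<open>x\<close> integral; replacing \<open>x\<close> by
      its residue representative gives the centre of its subdisk.\<close>
    let ?c = "\<lambda>t. 1 + p ^ Suc n * t"
    have small: "absF (p ^ Suc n * t) < 1" if "absF t \<le> 1" for t
    proof -
      have "absF (p ^ Suc n * t) \<le> ?Q ^ Suc n"
        using that by (simp add: absF_mult mult_left_le)
      also have "\<dots> < 1" using Q power_Suc_less_one by blast
      finally show ?thesis .
    qed
    have pn: "p ^ Suc n \<noteq> 0" using Q by auto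
    have scale: "absF (p ^ Suc n * x) \<le> ?Q ^ Suc (Suc n) \<longleftrightarrow> absF x < 1" for x
      using Q uniformizer_dvd[OF assms(1), of x] by (simp add: absF_mult)
    have scale': "absF (p ^ Suc n * x) \<le> ?Q ^ Suc n \<longleftrightarrow> absF x \<le> 1" for x
      using Q by (simp add: absF_mult)
    have "{a. absF (a - 1) \<le> ?Q ^ Suc n} = (\<Union>t\<in>T. {a. absF (a - ?c t) \<le> ?Q ^ Suc (Suc n)})"
    proof (intro equalityI subsetI)
      fix a :: 'a assume a: "a \<in> {a. absF (a - 1) \<le> ?Q ^ Suc n}"
      define x where "x = (a - 1) / p ^ Suc n"
      have x: "a = 1 + p ^ Suc n * x" using pn by (simp add: x_def)
      have "absF x \<le> 1" using a scale'[of x] unfolding x by simp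
      then obtain t where t: "t \<in> T" "absF (x - t) < 1" using T(4) by blast
      then show "a \<in> (\<Union>t\<in>T. {a. absF (a - ?c t) \<le> ?Q ^ Suc (Suc n)})"
        using scale[of "x - t"] by (auto simp: x right_diff_distrib intro!: bexI[of _ t])
    next
      fix a :: 'a assume "a \<in> (\<Union>t\<in>T. {a. absF (a - ?c t) \<le> ?Q ^ Suc (Suc n)})"
      then obtain t where t: "t \<in> T" "absF (a - ?c t) \<le> ?Q ^ Suc (Suc n)" by blast
      have "absF (a - ?c t) \<le> ?Q ^ Suc n"
        using t(2) Q by (elim order_trans) (simp add: mult_left_le_one_le)
      moreover have "absF (p ^ Suc n * t) \<le> ?Q ^ Suc n"
        using T(3)[OF t(1)] scale' by blast
      ultimately have "absF (a - ?c t + p ^ Suc n * t) \<le> ?Q ^ Suc n" by (rule absF_add_le)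
      then show "a \<in> {a. absF (a - 1) \<le> ?Q ^ Suc n}" by simp
    qed
    moreover have "measure \<mu> (\<Union>t\<in>T. {a. absF (a - ?c t) \<le> ?Q ^ Suc (Suc n)}) =
      real (card T) * measure \<mu> {a. absF (a - 1) \<le> ?Q ^ Suc (Suc n)}"
      using assms(2) power_Suc_less_one[OF Q, of "Suc n"] T(1)
    proof (rule measure_UN_disks)
      show "absF (?c t) = 1" if "t \<in> T" for t
        using absF_near_unit[of 1 "?c t"] small[OF T(3)[OF that]] by (simp del: power_Suc)
      show "t = t'" if "t \<in> T" "t' \<in> T" "absF (?c t - ?c t') \<le> ?Q ^ Suc (Suc n)" for t t'
        using that T(5) scale[of "t - t'"] by (simp del: power_Suc flip: right_diff_distrib)
    qed
    ultimately have "measure \<mu> {a. absF (a - 1) \<le> ?Q ^ Suc (Suc n)} =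
        ?Q * measure \<mu> {a. absF (a - 1) \<le> ?Q ^ Suc n}"
      using Q card by (simp only:) simp
    then show ?case
      unfolding Suc.IH by simp
  qed
qed

text \<open>Sum and integral may be exchanged because each set has volume 1 and the norms form a
  convergent geometric series. The powers start at \<open>Suc j\<close> because the shell of units
  is treated separately.\<close>

lemma has_bochner_integral_shells:
  fixes z :: complex and \<mu> :: "'a measure" and S :: "nat \<Rightarrow> 'a set"
  assumes S: "\<And>j. S j \<in> sets \<mu>" "\<And>j. emeasure \<mu> (S j) = 1" "disjoint_family S" and z: "norm z < 1"
  shows "has_bochner_integral \<mu> (\<lambda>a. \<Sum>j. indicator (S j) a *\<^sub>R z ^ Suc j) (z / (1 - z))"
proof -
  have int: "has_bochner_integral \<mu> (\<lambda>a. indicator (S j) a *\<^sub>R c) c" for j and c :: "'b::{banach, second_countable_topology}"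
    using has_bochner_integral_indicator[of "S j" \<mu> c] S by (simp add: measure_def)
  have norm: "(\<lambda>a. norm (indicator (S j) a *\<^sub>R z ^ Suc j)) = (\<lambda>a. indicator (S j) a *\<^sub>R (norm z ^ Suc j))" for j
    by (auto simp: norm_mult norm_power fun_eq_iff indicator_def)
  have 1: "integrable \<mu> (\<lambda>a. indicator (S j) a *\<^sub>R z ^ Suc j)" for j
    using int has_bochner_integral_iff by blast
  have geom: "summable (\<lambda>j. norm z ^ Suc j)"
    by (subst summable_Suc_iff) (use z in simp)
  have 2: "AE a in \<mu>. summable (\<lambda>j. norm (indicator (S j) a *\<^sub>R z ^ Suc j))"
    by (intro AE_I2 summable_comparison_test[OF _ geom])
      (auto simp: norm_mult norm_power indicator_def)
  have 3: "summable (\<lambda>j. LINT a|\<mu>. norm (indicator (S j) a *\<^sub>R z ^ Suc j))"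
    unfolding norm has_bochner_integral_integral_eq[OF int]
    by (rule geom)
  have "(\<Sum>j. LINT a|\<mu>. indicator (S j) a *\<^sub>R z ^ Suc j) = z / (1 - z)"
    using sums_mult[OF geometric_sums[OF z], of z]
    unfolding has_bochner_integral_integral_eq[OF int] by (simp add: sums_iff)
  then show ?thesis
    using integrable_suminf[OF 1 2 3] integral_suminf[OF 1 2 3] by (simp add: has_bochner_integral_iff)
qed

lemma suminf_indicator_disjoint:
  fixes c :: "nat \<Rightarrow> 'b::real_normed_vector"
  assumes "disjoint_family S" "a \<in> S j"
  shows "(\<Sum>j. indicator (S j) a *\<^sub>R c j) = c j"
proof -
  have "indicator (S i) a *\<^sub>R c i = (if i = j then c i else 0)" for i
    using assms by (auto simp: disjoint_family_on_def indicator_def)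
  then show ?thesis using sums_single[of j c] by (simp add: sums_iff)
qed

section \<open>The integral at \<open>\<eta>\<^sub>k\<close>\<close>

lemma sqrt_power_int: "sqrt (x powi n) = sqrt x powi n"
  by (simp add: power_int_def real_sqrt_power real_sqrt_inverse)

text \<open>Here \<open>n\<close> and \<open>m\<close> are the valuations of the determinant and of
  the bottom row, so the diagonal of a Borel part of \<open>g\<close> has valuations
  \<open>n - m\<close> and \<open>m\<close>.\<close>

lemma spherical_fun_value:
  fixes p :: "'a::nonarch_local_field"
  assumes "unramified_quasicharacter \<xi>1" "unramified_quasicharacter \<xi>2" "p \<noteq> 0"
    and det: "absF (det g) = absF p powi n" and norm: "bottom_norm g = absF p powi m"
  shows "spherical_fun \<xi>1 \<xi>2 g =
    \<xi>1 p powi (n - m) * \<xi>2 p powi m * complex_of_real (sqrt (absF p)) powi (n - 2 * m)"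
proof -
  have g: "g \<in> GL2"
    using assms by (auto simp: GL2_iff simp flip: absF_eq_0_iff)
  have "\<xi>1 (det g / bottom_gen g) = \<xi>1 p powi (n - m)"
    using assms by (intro unramified_eq_powi) (auto simp: absF_divide absF_bottom_gen power_int_diff)
  moreover have "\<xi>2 (bottom_gen g) = \<xi>2 p powi m"
    using assms by (intro unramified_eq_powi) (auto simp: absF_bottom_gen)
  moreover have "absF (det g) / (bottom_norm g)\<^sup>2 = absF p powi (n - 2 * m)"
    using assms(3) power_int_mult[of "absF p" m 2]
    by (simp add: det norm power_int_diff mult.commute[of 2 m])
  ultimately show ?thesis
    using g by (simp add: spherical_fun_def powr_half_sqrt sqrt_power_int)
qed

lemma W_integrand_spherical:
  assumes "g \<in> GL2" "a \<noteq> 0"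
  shows "W_integrand \<sigma> (right_transl g f) a = f (mat2 0 1 a 1 ** g) * inverse (\<sigma> a)"
proof -
  have "mat2 0 1 1 0 ** mat2 1 1 0 1 ** mat2 a 0 0 1 = mat2 0 1 a 1"
    by (rule mat2_eqI) (simp_all add: matrix_mult_nth_2)
  moreover have "mat2 0 1 a 1 \<in> GL2" using assms by (simp add: GL2_iff)
  ultimately show ?thesis by (simp add: W_integrand_def right_transl_def)
qed

lemma eta_eq: "eta p k = mat2 (p ^ k) 1 0 1"
  by (rule mat2_eqI) (simp_all add: eta_def matrix_mult_nth_2)

lemma eta_in_GL2: "p \<noteq> 0 \<Longrightarrow> eta p k \<in> GL2"
  by (simp add: eta_eq GL2_iff)

text \<open>The argument of the spherical function has determinant \<open>- a * p ^ k\<close> and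
  bottom row \<open>(a * p ^ k, a + 1)\<close>; \<open>j\<close> and \<open>m\<close> are the
  valuations of \<open>a\<close> and of that row.\<close>

lemma W_integrand_eta:
  fixes p :: "'a::nonarch_local_field"
  assumes "unramified_quasicharacter \<xi>1" "unramified_quasicharacter \<xi>2"
    "unramified_quasicharacter \<sigma>" "p \<noteq> 0"
    and a: "absF a = absF p powi j"
    and m: "max (absF p powi (j + int k)) (absF (a + 1)) = absF p powi m"
  shows "W_integrand \<sigma> (right_transl (eta p k) (spherical_fun \<xi>1 \<xi>2)) a =
    \<xi>1 p powi (j + int k - m) * \<xi>2 p powi m * 
      complex_of_real (sqrt (absF p)) powi (j + int k - 2 * m) * inverse (\<sigma> p powi j)"
proof -
  have a0: "a \<noteq> 0" using a assms(4) by (auto simp flip: absF_eq_0_iff)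
  have eq: "mat2 0 1 a 1 ** eta p k = mat2 0 1 (a * p ^ k) (a + 1)"
    by (rule mat2_eqI) (simp_all add: eta_eq matrix_mult_nth_2)
  have ak: "absF (a * p ^ k) = absF p powi (j + int k)"
    using assms by (simp add: absF_mult power_int_add)
  have "spherical_fun \<xi>1 \<xi>2 (mat2 0 1 a 1 ** eta p k) = \<xi>1 p powi (j + int k - m) * \<xi>2 p powi m * 
      complex_of_real (sqrt (absF p)) powi (j + int k - 2 * m)"
    unfolding eq using assms(1,2,4)
    by (rule spherical_fun_value) (simp_all add: ak bottom_norm_def m)
  moreover have "\<sigma> a = \<sigma> p powi j"
    using assms by (intro unramified_eq_powi)
  ultimately show ?thesis
    using a0 assms by (simp add: W_integrand_spherical eta_in_GL2)
qed

text \<open>Abel summation: a function of the depth \<open>i\<close> in a nested family is written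
  through indicators of the sets themselves, so that only volumes of full disks are needed, not of
  annuli.\<close>

lemma sum_indicator_telescope:
  fixes c :: "nat \<Rightarrow> 'b::real_normed_vector"
  assumes "a \<in> U 0" "i \<le> k" "\<And>j. j < k \<Longrightarrow> a \<in> U (Suc j) \<longleftrightarrow> j < i"
  shows "indicator (U 0) a *\<^sub>R c 0 + (\<Sum>j<k. indicator (U (Suc j)) a *\<^sub>R (c (Suc j) - c j)) = c i"
proof -
  have "(\<Sum>j<k. indicator (U (Suc j)) a *\<^sub>R (c (Suc j) - c j)) = (\<Sum>j<i. c (Suc j) - c j)"
    using assms by (intro sum.mono_neutral_cong_right) auto
  then show ?thesis
    using assms(1) by (simp add: sum_lessThan_telescope)
qed

text \<open>The first two terms come from \<open>absF a\<close> below and above 1. On the units the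
  integrand depends only on the valuation of \<open>a + 1\<close> capped at \<open>k\<close>, and
  \<open>c i\<close> is its value at capped valuation \<open>i\<close>; Abel summation weights the
  differences of \<open>c\<close> by volumes of disks around -1.\<close>

lemma has_bochner_integral_eta:
  fixes p :: "'a::nonarch_local_field" and \<mu> :: "'a measure" and k :: nat
  defines "Q \<equiv> absF p" and "r \<equiv> complex_of_real (sqrt (absF p))"
  assumes p: "uniformizer p" and \<mu>: "mult_haar_measure \<mu>"
    and ur: "unramified_quasicharacter \<xi>1" "unramified_quasicharacter \<xi>2" "unramified_quasicharacter \<sigma>"
  defines "x \<equiv> \<xi>1 p * inverse (\<sigma> p) * r" and "y \<equiv> inverse (\<xi>2 p) * \<sigma> p * r"
    and "c \<equiv> (\<lambda>i. (\<xi>1 p * r) ^ (k - i) * (\<xi>2 p / r) ^ i)"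
  assumes x: "norm x < 1" and y: "norm y < 1"
  shows "has_bochner_integral \<mu> (W_integrand \<sigma> (right_transl (eta p k) (spherical_fun \<xi>1 \<xi>2)))
    ((\<xi>1 p * r) ^ k * (x / (1 - x)) + (\<xi>1 p * r) ^ k * (y / (1 - y)) +
      (c 0 + (\<Sum>i<k. (Q ^ Suc i / (1 - Q)) *\<^sub>R (c (Suc i) - c i))))"
proof -
  have p0: "p \<noteq> 0" using p by (rule uniformizer_nonzero)
  have Q: "0 < Q" "Q < 1" using p p0 by (simp_all add: Q_def uniformizer_less_1)
  have r: "r \<noteq> 0" using Q by (simp add: r_def Q_def)
  define S where "S j = {a::'a. absF a = Q powi j}" for j :: int
  define U where "U i = {a::'a. absF a = 1 \<and> absF (a + 1) \<le> Q ^ i}" for i :: nat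
  have Qinj: "Q powi i = Q powi j \<longleftrightarrow> i = j" for i j
    using Q by (smt (verit) power_int_strict_decreasing)
  have S: "S j \<in> sets \<mu>" "emeasure \<mu> (S j) = 1" for j
    using Q \<mu> p0 by (auto simp: S_def Q_def intro!: sets_shell emeasure_shell)
  have disj: "disjoint_family (\<lambda>j. S (int (Suc j)))" "disjoint_family (\<lambda>j. S (- int (Suc j)))"
    by (auto simp: disjoint_family_on_def S_def Qinj)
  have U0: "U 0 = S 0"
    by (auto simp: U_def S_def intro: absF_add_le)
  \<comment> \<open>Points this close to -1 are automatically units, so \<open>U\<close> at a
    positive index is a full disk.\<close>
  have U1: "U (Suc i) = {a. absF (a - (-1)) \<le> Q ^ Suc i}" for i
    using absF_near_unit[of "-1"] power_Suc_less_one[OF Q, of i] by (force simp: U_def)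
  have Us: "U (Suc i) \<in> sets \<mu>" "emeasure \<mu> (U (Suc i)) = ennreal (Q ^ Suc i / (1 - Q))" for i
  proof -
    have lt: "Q ^ Suc i < 1" using power_Suc_less_one[OF Q] .
    show "U (Suc i) \<in> sets \<mu>" 
      unfolding U1 using \<mu> lt by (intro sets_disk) auto
    have "emeasure \<mu> (U (Suc i)) = emeasure \<mu> {a. absF (a - 1) \<le> Q ^ Suc i}"
      unfolding U1 using \<mu> lt by (intro emeasure_disk_eq) auto
    also have "\<dots> = measure \<mu> {a. absF (a - 1) \<le> Q ^ Suc i}"
      using emeasure_disk_le_1[OF \<mu> absF_1 lt] by (intro emeasure_eq_ennreal_measure) (auto simp: top_unique)
    finally show "emeasure \<mu> (U (Suc i)) = ennreal (Q ^ Suc i / (1 - Q))"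
      using measure_disk[OF p \<mu>] by (simp only: Q_def)
  qed
  have 1: "has_bochner_integral \<mu> (\<lambda>a. \<Sum>j. indicator (S (int (Suc j))) a *\<^sub>R x ^ Suc j) (x / (1 - x))"
    by (intro has_bochner_integral_shells S disj x)
  have 2: "has_bochner_integral \<mu> (\<lambda>a. \<Sum>j. indicator (S (- int (Suc j))) a *\<^sub>R y ^ Suc j) (y / (1 - y))"
    by (intro has_bochner_integral_shells S disj y)
  have 30: "has_bochner_integral \<mu> (\<lambda>a. indicator (U 0) a *\<^sub>R c 0) (c 0)"
    using has_bochner_integral_indicator[of "U 0" \<mu> "c 0"] S[of 0] by (simp add: U0 measure_def)
  have 31: "has_bochner_integral \<mu> (\<lambda>a. indicator (U (Suc i)) a *\<^sub>R d) ((Q ^ Suc i / (1 - Q)) *\<^sub>R d)"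
    for i and d :: complex
    using has_bochner_integral_indicator[of "U (Suc i)" \<mu> d] Us[of i] Q
    by (simp add: measure_def del: scaleR_conv_of_real power_Suc)
  have 3: "has_bochner_integral \<mu> (\<lambda>a. indicator (U 0) a *\<^sub>R c 0 +
      (\<Sum>i<k. indicator (U (Suc i)) a *\<^sub>R (c (Suc i) - c i)))
      (c 0 + (\<Sum>i<k. (Q ^ Suc i / (1 - Q)) *\<^sub>R (c (Suc i) - c i)))"
    by (intro has_bochner_integral_add has_bochner_integral_sum 30 31)
  let ?f = "\<lambda>a. (\<xi>1 p * r) ^ k * (\<Sum>j. indicator (S (int (Suc j))) a *\<^sub>R x ^ Suc j) + 
    (\<xi>1 p * r) ^ k * (\<Sum>j. indicator (S (- int (Suc j))) a *\<^sub>R y ^ Suc j) +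
    (indicator (U 0) a *\<^sub>R c 0 + (\<Sum>i<k. indicator (U (Suc i)) a *\<^sub>R (c (Suc i) - c i)))"
  have "W_integrand \<sigma> (right_transl (eta p k) (spherical_fun \<xi>1 \<xi>2)) a = ?f a" if a: "a \<in> space \<mu>" for a
  proof -
    let ?J = "W_integrand \<sigma> (right_transl (eta p k) (spherical_fun \<xi>1 \<xi>2)) a"
    have "a \<noteq> 0" using a mult_haar_space[OF \<mu>] by simp
    then obtain j where j: "absF a = Q powi j"
      using absF_eq_powi[OF p] unfolding Q_def by blast
    have J: "?J = \<xi>1 p powi (j + int k - m) * \<xi>2 p powi m * 
        r powi (j + int k - 2 * m) * inverse (\<sigma> p powi j)"
      if "max (Q powi (j + int k)) (absF (a + 1)) = Q powi m" for m
      using W_integrand_eta[OF ur p0 j[unfolded Q_def] that[unfolded Q_def]] by (simp add: r_def)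
    have aS: "a \<in> S i \<longleftrightarrow> i = j" for i using j by (auto simp: S_def Qinj)
    have aU: "a \<notin> U i" if "j \<noteq> 0" for i
      using that j Qinj[of j 0] by (auto simp: U_def)
    consider i where "j = int (Suc i)" | i where "j = - int (Suc i)" | "j = 0"
      by (metis int_cases3 Suc_pred)
    then show ?thesis
    proof cases
      \<comment> \<open>Here 1 dominates in \<open>a + 1\<close>, and the bottom row has norm 1, so
        \<open>m = 0\<close>.\<close>
      case (1 i)
      have "absF a < 1"
        unfolding j 1 using power_Suc_less_one[OF Q, of i] by (simp only: power_int_of_nat)
      then have "absF (a + 1) = 1" using absF_add_eq[of a 1] by simp
      moreover have "Q powi (j + int k) \<le> 1"
        unfolding 1 of_nat_add[symmetric] power_int_of_nat using Q by (intro power_le_one) auto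
      ultimately have "?J = \<xi>1 p powi (j + int k) * r powi (j + int k) * inverse (\<sigma> p powi j)"
        using J[of 0] by simp
      also have "\<dots> = (\<xi>1 p * r) ^ k * x ^ Suc i"
        unfolding 1 of_nat_add[symmetric] power_int_of_nat x_def
        by (simp add: power_add power_mult_distrib power_inverse mult_ac)
      finally have "?J = (\<xi>1 p * r) ^ k * x ^ Suc i" .
      moreover have "(\<Sum>j. indicator (S (int (Suc j))) a *\<^sub>R x ^ Suc j) = x ^ Suc i"
        by (rule suminf_indicator_disjoint[where S = "\<lambda>j. S (int (Suc j))"]) (use disj aS 1 in auto)
      moreover have "(\<Sum>j. indicator (S (- int (Suc j))) a *\<^sub>R y ^ Suc j) = 0"
        using aS 1 by (simp add: indicator_def)
      ultimately show ?thesis using aU 1 by simp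
    next
      \<comment> \<open>Here \<open>a\<close> dominates in \<open>a + 1\<close>, whose absolute
        value is at least that of \<open>a * p ^ k\<close>, so \<open>m = j\<close>. As
        \<open>j\<close> is negative, powers of \<open>y\<close> appear.\<close>
      case (2 i)
      have "absF 1 < absF a"
        unfolding j 2 using one_less_power[of "inverse Q" "Suc i"] Q
        by (simp add: power_int_minus power_inverse one_less_inverse_iff del: power_Suc of_nat_Suc)
      then have "absF (a + 1) = Q powi j" using absF_add_eq[of 1 a] j by (simp add: add.commute)
      moreover have "Q powi (j + int k) \<le> Q powi j"
        using Q by (intro power_int_decreasing) auto
      ultimately have "?J = \<xi>1 p ^ k * \<xi>2 p powi j * r powi (int k - j) * inverse (\<sigma> p powi j)"
        using J[of j] by (simp add: algebra_simps)
      also have "\<dots> = (\<xi>1 p * r) ^ k * y ^ Suc i"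
      proof -
        have "r powi (int k - j) = r ^ (k + Suc i)"
          unfolding 2 by (metis diff_minus_eq_add of_nat_add power_int_of_nat)
        then show ?thesis
          unfolding 2 power_int_minus power_int_of_nat y_def
          by (simp add: power_add power_mult_distrib power_inverse mult_ac del: of_nat_Suc)
      qed
      finally have "?J = (\<xi>1 p * r) ^ k * y ^ Suc i" .
      moreover have "(\<Sum>j. indicator (S (- int (Suc j))) a *\<^sub>R y ^ Suc j) = y ^ Suc i"
        by (rule suminf_indicator_disjoint[where S = "\<lambda>j. S (- int (Suc j))"]) (use disj aS 2 in auto)
      moreover have "(\<Sum>j. indicator (S (int (Suc j))) a *\<^sub>R x ^ Suc j) = 0"
        using aS 2 by (simp add: indicator_def)
      ultimately show ?thesis using aU 2 by simp
    next
      case 3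
      have a1: "absF a = 1" using j 3 by simp
      have le1: "absF (a + 1) \<le> 1" using a1 by (intro absF_add_le) auto
      \<comment> \<open>The index \<open>i\<close> is the valuation of \<open>a + 1\<close> capped
        at \<open>k\<close>; the point \<open>a = -1\<close>, where that valuation is infinite, gets
        \<open>i = k\<close>.\<close>
      obtain i where i: "i \<le> k" "max (Q ^ k) (absF (a + 1)) = Q ^ i"
      proof (cases "absF (a + 1) \<le> Q ^ k")
        case False
        then have "a + 1 \<noteq> 0" using Q by auto
        then obtain m where m: "absF (a + 1) = Q powi m"
          using absF_eq_powi[OF p] unfolding Q_def by blast
        have "m \<ge> 0"
        proof (rule ccontr)
          assume "\<not> m \<ge> 0"
          then have "Q powi 0 < Q powi m" using Q by (intro power_int_strict_decreasing) auto
          then show False using le1 m by simp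
        qed
        then obtain i where i: "m = int i" using zero_le_imp_eq_int by blast
        have "i \<le> k"
        proof (rule ccontr)
          assume "\<not> i \<le> k"
          then have "Q ^ i \<le> Q ^ k" using Q by (intro power_decreasing) auto
          then show False using False m i by simp
        qed
        then show ?thesis using False m i by (intro that[of i]) auto
      qed (auto intro: that[of k])
      have "a \<in> U 0" using a1 le1 by (simp add: U_def)
      moreover have "a \<in> U (Suc l) \<longleftrightarrow> l < i" if "l < k" for l
      proof -
        \<comment> \<open>For \<open>l < k\<close> the cap \<open>Q ^ k\<close> is itself at most
          \<open>Q ^ Suc l\<close>, so it does not affect membership in the disk.\<close>
        have "Q ^ k \<le> Q ^ Suc l" using that Q by (intro power_decreasing) auto
        then have "absF (a + 1) \<le> Q ^ Suc l \<longleftrightarrow> Q ^ i \<le> Q ^ Suc l"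
          unfolding i(2)[symmetric] by simp
        also have "\<dots> \<longleftrightarrow> Suc l \<le> i" using Q by (intro power_decreasing_iff) auto
        finally show ?thesis using a1 by (auto simp: U_def)
      qed
      ultimately have "indicator (U 0) a *\<^sub>R c 0 + (\<Sum>i<k. indicator (U (Suc i)) a *\<^sub>R (c (Suc i) - c i)) = c i"
        using i(1) by (intro sum_indicator_telescope)
      moreover have "(\<Sum>j. indicator (S (int (Suc j))) a *\<^sub>R x ^ Suc j) = 0"
        "(\<Sum>j. indicator (S (- int (Suc j))) a *\<^sub>R y ^ Suc j) = 0"
        using aS 3 by (simp_all add: indicator_def)
      moreover have "?J = c i"
      proof -
        have "?J = \<xi>1 p powi (int k - int i) * \<xi>2 p powi int i * r powi (int k - 2 * int i)"
          using J[of "int i"] 3 i by simp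
        moreover have "\<xi>1 p powi (int k - int i) = \<xi>1 p ^ (k - i)"
          using i(1) by (metis of_nat_diff power_int_of_nat)
        moreover have "r powi (int k - 2 * int i) = r ^ (k - i) / r ^ i"
        proof -
          have "int k - 2 * int i = int (k - i) - int i" using i(1) by auto
          then show ?thesis using r by (metis power_int_diff power_int_of_nat)
        qed
        ultimately show ?thesis by (simp add: c_def power_mult_distrib power_divide)
      qed
      ultimately show ?thesis by simp
    qed
  qed
  moreover have "has_bochner_integral \<mu> ?f ((\<xi>1 p * r) ^ k * (x / (1 - x)) + (\<xi>1 p * r) ^ k * (y / (1 - y)) +
      (c 0 + (\<Sum>i<k. (Q ^ Suc i / (1 - Q)) *\<^sub>R (c (Suc i) - c i))))"
    by (intro has_bochner_integral_add[OF has_bochner_integral_add] has_bochner_integral_mult_right 1 2 3)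
  ultimately show ?thesis
    by (subst has_bochner_integral_cong[OF refl _ refl])
qed

section \<open>Cancellation of the denominators and symmetry in the two parameters\<close>

text \<open>
  The explicit value with the denominators \<open>\<gamma>\<^sub>1 - \<gamma>\<^sub>2\<close> cancelled, in terms of \<open>Q = q\<^sup>-\<^sup>1\<close>.
\<close>

definition continued_value :: "real \<Rightarrow> nat \<Rightarrow> complex \<times> complex \<times> complex \<Rightarrow> complex"
  where "continued_value Q k = (\<lambda>(\<gamma>1, \<gamma>2, \<tau>). let r = complex_of_real (sqrt Q) in
    r ^ k * (\<gamma>1 ^ k + (1 - \<gamma>1 * inverse \<tau> * r) * (1 - inverse \<gamma>2 * \<tau> * r) * \<gamma>2 *
      (\<Sum>i<k. \<gamma>1 ^ (k - Suc i) * \<gamma>2 ^ i) * inverse (1 - complex_of_real Q)))"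

text \<open>The finite sum in \<open>continued_value\<close> is the difference quotient of the k-th
  powers; what remains is a relation between the two numerators of
  \<open>explicit_value\<close>.\<close>

lemma continued_value_eq_explicit:
  assumes "0 < Q" "Q < 1" "\<gamma>1 \<noteq> 0" "\<gamma>2 \<noteq> 0" "\<tau> \<noteq> 0" "\<gamma>1 \<noteq> \<gamma>2"
  shows "continued_value Q k (\<gamma>1, \<gamma>2, \<tau>) = explicit_value (inverse Q) k \<gamma>1 \<gamma>2 \<tau>"
proof -
  define r where "r = complex_of_real (sqrt Q)"
  define h where "h = (\<Sum>i<k. \<gamma>1 ^ (k - Suc i) * \<gamma>2 ^ i)"
  have r2: "complex_of_real Q = r ^ 2"
    using assms by (simp add: r_def flip: of_real_power)
  have r: "inverse Q powr (-1/2) = sqrt Q"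
    using assms by (simp add: powr_minus powr_half_sqrt real_sqrt_inverse flip: minus_divide_left)
  have "inverse Q powr (- real k / 2) = (inverse Q powr (-1/2)) powr real k"
    using assms by (simp add: powr_powr)
  also have "\<dots> = sqrt Q ^ k"
    unfolding r using assms by (simp add: powr_realpow)
  finally have rk: "complex_of_real (inverse Q powr (- real k / 2)) = r ^ k"
    by (simp add: r_def)
  have Q1: "1 - r ^ 2 \<noteq> 0"
    using assms unfolding r2[symmetric] by (metis eq_iff_diff_eq_0 less_irrefl of_real_1 of_real_eq_iff)
  have "\<gamma>2 ^ k - \<gamma>1 ^ k = (\<gamma>2 - \<gamma>1) * h"
    unfolding h_def by (rule power_diff_sumr2)
  then have h: "h = (\<gamma>2 ^ k - \<gamma>1 ^ k) / (\<gamma>2 - \<gamma>1)"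
    using assms by (simp add: field_simps)
  have 1: "1 - inverse \<gamma>1 * \<gamma>2 = (\<gamma>1 - \<gamma>2) / \<gamma>1" "1 - \<gamma>1 * inverse \<gamma>2 = - (\<gamma>1 - \<gamma>2) / \<gamma>2"
    "\<gamma>2 - \<gamma>1 = - (\<gamma>1 - \<gamma>2)"
    using assms by (simp_all add: field_simps)
  have d: "\<gamma>1 - \<gamma>2 \<noteq> 0" using assms by simp
  define A B D where "A = \<gamma>1 ^ k" and "B = \<gamma>2 ^ k" and "D = \<gamma>1 - \<gamma>2"
  have "A + (1 - \<gamma>1 * inverse \<tau> * r) * (1 - inverse \<gamma>2 * \<tau> * r) * \<gamma>2 * ((B - A) / (- D)) * inverse (1 - r ^ 2) =
     inverse (1 - r ^ 2) * (A * ((1 - \<gamma>2 * inverse \<tau> * r) * (1 - inverse \<gamma>1 * \<tau> * r) / (D / \<gamma>1))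
       + B * ((1 - \<gamma>1 * inverse \<tau> * r) * (1 - inverse \<gamma>2 * \<tau> * r) / (- D / \<gamma>2)))"
  proof -
    have D: "D \<noteq> 0" using d by (simp add: D_def)
    have x: "(1 - \<gamma>1 * inverse \<tau> * r) * (1 - inverse \<gamma>2 * \<tau> * r) * \<gamma>2 = \<gamma>2 + \<gamma>1 * r ^ 2 - \<tau> * r - \<gamma>1 * \<gamma>2 * r / \<tau>"
      using assms by (simp add: field_simps power2_eq_square)
    have y: "(1 - \<gamma>2 * inverse \<tau> * r) * (1 - inverse \<gamma>1 * \<tau> * r) * \<gamma>1 = \<gamma>1 + \<gamma>2 * r ^ 2 - \<tau> * r - \<gamma>1 * \<gamma>2 * r / \<tau>"
      using assms by (simp add: field_simps power2_eq_square)
    \<comment> \<open>\<open>X\<close> is the numerator attached to \<open>\<gamma>2 ^ k\<close>,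
      multiplied by \<open>\<gamma>2\<close>. The other numerator, multiplied by
      \<open>\<gamma>1\<close>, exceeds it by \<open>D * (1 - r ^ 2)\<close>; this excess cancels
      both denominators and leaves the isolated term \<open>A\<close>.\<close>
    define X where "X = \<gamma>2 + \<gamma>1 * r ^ 2 - \<tau> * r - \<gamma>1 * \<gamma>2 * r / \<tau>"
    have y': "\<gamma>1 + \<gamma>2 * r ^ 2 - \<tau> * r - \<gamma>1 * \<gamma>2 * r / \<tau> = X + D * (1 - r ^ 2)"
      by (simp add: X_def D_def algebra_simps)
    have m1: "A * ((1 - \<gamma>2 * inverse \<tau> * r) * (1 - inverse \<gamma>1 * \<tau> * r) / (D / \<gamma>1)) = A * (X + D * (1 - r ^ 2)) / D"
      unfolding y'[symmetric] y[symmetric] by simp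
    have m2: "B * ((1 - \<gamma>1 * inverse \<tau> * r) * (1 - inverse \<gamma>2 * \<tau> * r) / (- D / \<gamma>2)) = - B * X / D"
      unfolding X_def x[symmetric] by simp
    show ?thesis
      unfolding x X_def[symmetric] m1 m2 using Q1 D by (simp add: divide_simps) (simp add: algebra_simps)
  qed
  then show ?thesis
    unfolding continued_value_def explicit_value_def Let_def prod.case r rk inverse_inverse_eq
      r_def[symmetric] r2 1 h_def[symmetric] h A_def B_def D_def
    by (simp add: mult_ac)
qed

text \<open>Interchanging the parameters swaps the two summands of \<open>explicit_value\<close>; on
  the diagonal the claim is trivial.\<close>

lemma continued_value_commute:
  assumes "0 < Q" "Q < 1" "\<gamma>1 \<noteq> 0" "\<gamma>2 \<noteq> 0" "\<tau> \<noteq> 0"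
  shows "continued_value Q k (\<gamma>1, \<gamma>2, \<tau>) = continued_value Q k (\<gamma>2, \<gamma>1, \<tau>)"
proof (cases "\<gamma>1 = \<gamma>2")
  case False
  have "explicit_value (inverse Q) k \<gamma>1 \<gamma>2 \<tau> = explicit_value (inverse Q) k \<gamma>2 \<gamma>1 \<tau>"
    unfolding explicit_value_def Let_def by (simp only: mult_ac add_ac)
  then show ?thesis
    using assms False continued_value_eq_explicit[of Q \<gamma>1 \<gamma>2 \<tau> k] continued_value_eq_explicit[of Q \<gamma>2 \<gamma>1 \<tau> k]
    by auto
qed simp

text \<open>Since \<open>x * y\<close> is \<open>\<gamma>1 * inverse \<gamma>2 * Q\<close>, the
  normalizing factor is (1 - x)(1 - y)/(1 - xy). It inverts x/(1 - x) + y/(1 - y) + 1 = (1 - xy)/((1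
  - x)(1 - y)), and each difference of \<open>c\<close> also contains the factor 1 - xy.\<close>

lemma eta_integral_normalized:
  fixes Q :: real and k :: nat and \<gamma>1 \<gamma>2 \<tau> :: complex
  defines "r \<equiv> complex_of_real (sqrt Q)"
  defines "x \<equiv> \<gamma>1 * inverse \<tau> * r" and "y \<equiv> inverse \<gamma>2 * \<tau> * r"
    and "c \<equiv> (\<lambda>i. (\<gamma>1 * r) ^ (k - i) * (\<gamma>2 / r) ^ i)"
  assumes Q: "0 < Q" "Q < 1" and nz: "\<gamma>1 \<noteq> 0" "\<gamma>2 \<noteq> 0" "\<tau> \<noteq> 0"
    and x: "norm x < 1" and y: "norm y < 1"
  shows "(1 - x) * (1 - y) / (1 - \<gamma>1 * inverse \<gamma>2 * complex_of_real Q) *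
      ((\<gamma>1 * r) ^ k * (x / (1 - x)) + (\<gamma>1 * r) ^ k * (y / (1 - y)) +
        (c 0 + (\<Sum>i<k. (Q ^ Suc i / (1 - Q)) *\<^sub>R (c (Suc i) - c i)))) =
    continued_value Q k (\<gamma>1, \<gamma>2, \<tau>)"
proof -
  define h where "h = (\<Sum>i<k. \<gamma>1 ^ (k - Suc i) * \<gamma>2 ^ i)"
  have r0: "r \<noteq> 0" using Q by (simp add: r_def)
  have r2: "complex_of_real Q = r ^ 2"
    using Q by (simp add: r_def flip: of_real_power)
  have Q1: "1 - r ^ 2 \<noteq> 0"
    using Q unfolding r2[symmetric] by (metis eq_iff_diff_eq_0 less_irrefl of_real_1 of_real_eq_iff)
  have xy: "\<gamma>1 * inverse \<gamma>2 * complex_of_real Q = x * y"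
    using nz by (simp add: r2 x_def y_def power2_eq_square)
  have "norm (x * y) < 1"
    using x y by (metis norm_ge_zero norm_mult mult_strict_mono' mult_1)
  then have x1: "1 - x \<noteq> 0" "1 - y \<noteq> 0" "1 - x * y \<noteq> 0"
    using x y by auto
  \<comment> \<open>The difference contains \<open>\<gamma>2 - \<gamma>1 * r ^ 2\<close>, which is
    \<open>\<gamma>2 * (1 - x * y)\<close>. The weight \<open>Q ^ Suc i\<close> is an even power of
    \<open>r\<close>; it clears the negative powers of \<open>r\<close> in \<open>c\<close> and
    leaves the common factor \<open>r ^ k\<close>.\<close>
  have term_eq: "(Q ^ Suc i / (1 - Q)) *\<^sub>R (c (Suc i) - c i) =
      r ^ k * (\<gamma>2 * (1 - x * y)) * inverse (1 - r ^ 2) * (\<gamma>1 ^ (k - Suc i) * \<gamma>2 ^ i)" if "i < k" for i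
  proof -
    obtain m where k: "k = Suc i + m" using \<open>i < k\<close> less_iff_Suc_add by auto
    have xy': "\<gamma>2 * (1 - x * y) = \<gamma>2 - \<gamma>1 * r ^ 2"
      using nz by (simp add: x_def y_def power2_eq_square field_simps)
    have c1: "(r\<^sup>2) ^ Suc i * c (Suc i) = r ^ k * (\<gamma>1 ^ m * \<gamma>2 ^ Suc i)"
      using r0 by (simp add: c_def k power_mult_distrib power_divide power_add power2_eq_square)
    have c2: "(r\<^sup>2) ^ Suc i * c i = r ^ k * (\<gamma>1 * r\<^sup>2 * (\<gamma>1 ^ m * \<gamma>2 ^ i))"
      using r0 by (simp add: c_def k power_mult_distrib power_divide power_add power2_eq_square Suc_diff_le)
    have "(Q ^ Suc i / (1 - Q)) *\<^sub>R (c (Suc i) - c i) =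
        ((r\<^sup>2) ^ Suc i * c (Suc i) - (r\<^sup>2) ^ Suc i * c i) * inverse (1 - r\<^sup>2)"
      by (simp add: scaleR_conv_of_real r2 field_simps)
    also have "\<dots> = r ^ k * (\<gamma>2 - \<gamma>1 * r\<^sup>2) * inverse (1 - r\<^sup>2) * (\<gamma>1 ^ m * \<gamma>2 ^ i)"
      unfolding c1 c2 by (simp add: algebra_simps)
    finally show ?thesis unfolding xy' by (simp add: k)
  qed
  have sum: "(\<Sum>i<k. (Q ^ Suc i / (1 - Q)) *\<^sub>R (c (Suc i) - c i)) =
      r ^ k * \<gamma>2 * inverse (1 - r ^ 2) * h * (1 - x * y)"
    unfolding h_def sum_distrib_left sum_distrib_right
    by (intro sum.cong refl) (simp add: term_eq mult_ac del: power_Suc)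
  \<comment> \<open>The value \<open>c 0\<close> equals the coefficient of both geometric series, so
    the same \<open>A\<close> occurs three times and the three terms combine.\<close>
  have "(1 - x) * (1 - y) / (1 - x * y) * (A * (x / (1 - x)) + A * (y / (1 - y)) + (A + w * (1 - x * y))) =
      A + (1 - x) * (1 - y) * w" for A w
  proof -
    have "A * (x / (1 - x)) + A * (y / (1 - y)) + (A + w * (1 - x * y)) =
        (1 - x * y) * (A / ((1 - x) * (1 - y)) + w)"
      using x1 by (simp add: divide_simps) (simp add: algebra_simps)
    moreover have "u * v / d * (d * (A / (u * v) + w)) = A + u * v * w"
      if "u \<noteq> 0" "v \<noteq> 0" "d \<noteq> 0" for u v d
      using that by (simp add: field_simps)
    ultimately show ?thesis using x1 by (simp only:)
  qed
  from this[of "(\<gamma>1 * r) ^ k" "r ^ k * \<gamma>2 * inverse (1 - r ^ 2) * h"]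
  have "(1 - x) * (1 - y) / (1 - \<gamma>1 * inverse \<gamma>2 * complex_of_real Q) *
      ((\<gamma>1 * r) ^ k * (x / (1 - x)) + (\<gamma>1 * r) ^ k * (y / (1 - y)) +
        (c 0 + (\<Sum>i<k. (Q ^ Suc i / (1 - Q)) *\<^sub>R (c (Suc i) - c i)))) =
    (\<gamma>1 * r) ^ k + (1 - x) * (1 - y) * (r ^ k * \<gamma>2 * inverse (1 - r ^ 2) * h)"
    unfolding sum xy by (simp add: c_def)
  also have "\<dots> = continued_value Q k (\<gamma>1, \<gamma>2, \<tau>)"
    unfolding continued_value_def Let_def prod.case r_def[symmetric] x_def[symmetric] y_def[symmetric]
      r2 h_def[symmetric]
    by (simp add: power_mult_distrib distrib_left mult_ac)
  finally show ?thesis .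
qed

section \<open>Holomorphy\<close>

text \<open>Differentiation rules yield derivatives of various shapes; it suffices to compare their
  values on triples with complex coefficients.\<close>

lemma holomorphic3_onI:
  assumes "\<And>z. z \<in> S \<Longrightarrow> (f has_derivative f' z) (at z)"
    and "\<And>z u v w. z \<in> S \<Longrightarrow> f' z (u, v, w) = a z * u + b z * v + c z * w"
  shows "holomorphic3_on f S"
  unfolding holomorphic3_on_def
proof
  fix z assume z: "z \<in> S"
  have "f' z = (\<lambda>(u, v, w). a z * u + b z * v + c z * w)"
    using assms(2)[OF z] by auto
  then show "\<exists>a b c. (f has_derivative (\<lambda>(u, v, w). a * u + b * v + c * w)) (at z)"
    using assms(1)[OF z] by metis
qed

lemma holomorphic3_const: "holomorphic3_on (\<lambda>z. c) S"
  by (rule holomorphic3_onI[where f' = "\<lambda>_ _. 0" and a = "\<lambda>_. 0" and b = "\<lambda>_. 0" and c = "\<lambda>_. 0"]) auto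

lemma holomorphic3_proj:
  "holomorphic3_on fst S" "holomorphic3_on (\<lambda>z. fst (snd z)) S" "holomorphic3_on (\<lambda>z. snd (snd z)) S"
proof -
  show "holomorphic3_on fst S"
    by (rule holomorphic3_onI[where f' = "\<lambda>_. fst" and a = "\<lambda>_. 1" and b = "\<lambda>_. 0" and c = "\<lambda>_. 0"])
      (auto intro!: derivative_eq_intros)
  show "holomorphic3_on (\<lambda>z. fst (snd z)) S"
    by (rule holomorphic3_onI[where f' = "\<lambda>_ z. fst (snd z)" and a = "\<lambda>_. 0" and b = "\<lambda>_. 1" and c = "\<lambda>_. 0"])
      (auto intro!: derivative_eq_intros)
  show "holomorphic3_on (\<lambda>z. snd (snd z)) S"
    by (rule holomorphic3_onI[where f' = "\<lambda>_ z. snd (snd z)" and a = "\<lambda>_. 0" and b = "\<lambda>_. 0" and c = "\<lambda>_. 1"])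
      (auto intro!: derivative_eq_intros)
qed

lemma holomorphic3_add:
  assumes "holomorphic3_on f S" "holomorphic3_on g S"
  shows "holomorphic3_on (\<lambda>z. f z + g z) S"
proof -
  obtain a b c where f: "\<forall>z\<in>S. (f has_derivative (\<lambda>(u, v, w). a z * u + b z * v + c z * w)) (at z)"
    using assms(1) unfolding holomorphic3_on_def by metis
  obtain a' b' c' where g: "\<forall>z\<in>S. (g has_derivative (\<lambda>(u, v, w). a' z * u + b' z * v + c' z * w)) (at z)"
    using assms(2) unfolding holomorphic3_on_def by metis
  show ?thesis
    by (rule holomorphic3_onI[OF has_derivative_add[OF bspec[OF f] bspec[OF g]],
          where a = "\<lambda>z. a z + a' z" and b = "\<lambda>z. b z + b' z" and c = "\<lambda>z. c z + c' z"])
      (auto simp: algebra_simps)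
qed

lemma holomorphic3_mult:
  assumes "holomorphic3_on f S" "holomorphic3_on g S"
  shows "holomorphic3_on (\<lambda>z. f z * g z) S"
proof -
  obtain a b c where f: "\<forall>z\<in>S. (f has_derivative (\<lambda>(u, v, w). a z * u + b z * v + c z * w)) (at z)"
    using assms(1) unfolding holomorphic3_on_def by metis
  obtain a' b' c' where g: "\<forall>z\<in>S. (g has_derivative (\<lambda>(u, v, w). a' z * u + b' z * v + c' z * w)) (at z)"
    using assms(2) unfolding holomorphic3_on_def by metis
  show ?thesis
    by (rule holomorphic3_onI[OF has_derivative_mult[OF bspec[OF f] bspec[OF g]],
          where a = "\<lambda>z. f z * a' z + a z * g z" and b = "\<lambda>z. f z * b' z + b z * g z"
            and c = "\<lambda>z. f z * c' z + c z * g z"])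
      (auto simp: algebra_simps)
qed

lemma holomorphic3_inverse:
  assumes "holomorphic3_on f S" "\<And>z. z \<in> S \<Longrightarrow> f z \<noteq> 0"
  shows "holomorphic3_on (\<lambda>z. inverse (f z)) S"
proof -
  obtain a b c where f: "\<forall>z\<in>S. (f has_derivative (\<lambda>(u, v, w). a z * u + b z * v + c z * w)) (at z)"
    using assms(1) unfolding holomorphic3_on_def by metis
  let ?i = "\<lambda>z. - inverse (f z) * inverse (f z)"
  show ?thesis
    by (rule holomorphic3_onI[OF Deriv.has_derivative_inverse[OF assms(2) bspec[OF f]],
          where a = "\<lambda>z. ?i z * a z" and b = "\<lambda>z. ?i z * b z" and c = "\<lambda>z. ?i z * c z"])
      (auto simp: algebra_simps)
qed

lemma holomorphic3_diff:
  assumes "holomorphic3_on f S" "holomorphic3_on g S"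
  shows "holomorphic3_on (\<lambda>z. f z - g z) S"
  using holomorphic3_add[OF assms(1) holomorphic3_mult[OF holomorphic3_const[of "-1"] assms(2)]] by simp

lemma holomorphic3_power:
  assumes "holomorphic3_on f S"
  shows "holomorphic3_on (\<lambda>z. f z ^ n) S"
  by (induction n) (auto intro: holomorphic3_const holomorphic3_mult assms)

lemma holomorphic3_power_int:
  assumes "holomorphic3_on f S" "\<And>z. z \<in> S \<Longrightarrow> f z \<noteq> 0"
  shows "holomorphic3_on (\<lambda>z. f z powi n) S"
  by (cases "n \<ge> 0")
    (auto simp: power_int_def intro!: holomorphic3_inverse holomorphic3_power assms)

lemma holomorphic3_sum:
  assumes "\<And>i. i \<in> I \<Longrightarrow> holomorphic3_on (f i) S"
  shows "holomorphic3_on (\<lambda>z. \<Sum>i\<in>I. f i z) S"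
  using assms by (induction I rule: infinite_finite_induct) (auto intro: holomorphic3_const holomorphic3_add)

text \<open>In the cancelled form the only inverted variables are \<open>\<gamma>2\<close> and
  \<open>\<tau>\<close>, which do not vanish on \<open>Cstar3\<close>; the diagonal causes no
  singularity.\<close>

lemma holomorphic3_continued_value: "holomorphic3_on (continued_value Q k) Cstar3"
  unfolding continued_value_def Let_def case_prod_unfold
  by (intro holomorphic3_mult holomorphic3_add holomorphic3_diff holomorphic3_power holomorphic3_sum
      holomorphic3_inverse[OF holomorphic3_proj(2)] holomorphic3_inverse[OF holomorphic3_proj(3)]
      holomorphic3_const holomorphic3_proj)
    (auto simp: Cstar3_def)

section \<open>Reduction to \<open>\<eta>\<^sub>k\<close>\<close>

lemma integral_matrices_mult:
  assumes "g \<in> integral_matrices" "h \<in> integral_matrices"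
  shows "g ** h \<in> integral_matrices"
  using assms
  by (auto simp: integral_matrices_def ring_of_integers_def matrix_mult_nth_2 absF_mult
      intro!: absF_add_le mult_le_one)

lemma K2_mult:
  assumes "g \<in> K2" "h \<in> K2"
  shows "g ** h \<in> K2"
proof -
  obtain g' h' where gh: "g' \<in> integral_matrices" "g ** g' = mat 1" "g' ** g = mat 1"
      "h' \<in> integral_matrices" "h ** h' = mat 1" "h' ** h = mat 1"
    using assms by (auto simp: K2_def)
  have "g ** h ** (h' ** g') = g ** (h ** h') ** g'" "h' ** g' ** (g ** h) = h' ** (g' ** g) ** h"
    by (simp_all add: matrix_mul_assoc)
  then have "g ** h ** (h' ** g') = mat 1" "h' ** g' ** (g ** h) = mat 1"
    using gh by simp_all
  then show ?thesis
    using assms gh integral_matrices_mult unfolding K2_def by blast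
qed

text \<open>The Iwasawa decomposition leaves an upper triangular matrix with top row \<alpha>,
  \<beta>. If \<beta> is at least as large as \<alpha>, the torus takes out \<beta>, and
  \<alpha>/\<beta> is \<open>p ^ k\<close> times a unit absorbed into \<open>K2\<close>. Otherwise
  the torus takes out \<alpha>, the unipotent part is integral, and \<open>k = 0\<close>.\<close>

lemma torus_eta_K2_decomposition:
  fixes g :: "'a::nonarch_local_field^2^2"
  assumes "uniformizer p" "g \<in> GL2"
  obtains t1 t2 k h where "t1 \<noteq> 0" "t2 \<noteq> 0" "h \<in> K2" "g = mat2 t1 0 0 t2 ** eta p k ** h"
proof -
  have p0: "p \<noteq> 0" using assms(1) by (rule uniformizer_nonzero)
  obtain h0 where h0: "h0 \<in> K2" "g ** h0 \<in> B2" using iwasawa[OF assms(2)] by blast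
  obtain h1 where h1: "h1 \<in> K2" "h0 ** h1 = mat 1"
    using h0(1) by (auto simp: K2_def)
  define \<alpha> \<beta> \<delta> where "\<alpha> = (g ** h0) $ 1 $ 1" and "\<beta> = (g ** h0) $ 1 $ 2" and "\<delta> = (g ** h0) $ 2 $ 2"
  have b: "g ** h0 = mat2 \<alpha> \<beta> 0 \<delta>"
    using h0(2) by (intro mat2_eqI) (auto simp: \<alpha>_def \<beta>_def \<delta>_def B2_def)
  have nz: "\<alpha> \<noteq> 0" "\<delta> \<noteq> 0"
    using h0(2) by (auto simp: b B2_def GL2_iff)
  have g: "g = mat2 \<alpha> \<beta> 0 \<delta> ** h1"
    using h1(2) by (simp flip: b matrix_mul_assoc)
  show ?thesis
  proof (cases "absF \<alpha> \<le> absF \<beta>")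
    case True
    then have "\<beta> \<noteq> 0" using nz by auto
    obtain j where j: "absF (\<alpha> / \<beta>) = absF p powi j"
      using absF_eq_powi[OF assms(1), of "\<alpha> / \<beta>"] nz \<open>\<beta> \<noteq> 0\<close> by auto
    have "absF p powi j \<le> 1"
      using True \<open>\<beta> \<noteq> 0\<close> by (simp flip: j add: absF_divide)
    have "j \<ge> 0"
    proof (rule ccontr)
      assume "\<not> j \<ge> 0"
      then have "absF p powi 0 < absF p powi j"
        using p0 uniformizer_less_1[OF assms(1)] by (intro power_int_strict_decreasing) auto
      with \<open>absF p powi j \<le> 1\<close> show False by simp
    qed
    then obtain k where k: "j = int k" using zero_le_imp_eq_int by blast
    define u where "u = \<alpha> / (\<beta> * p ^ k)"
    have "absF u = 1"
      using j p0 nz \<open>\<beta> \<noteq> 0\<close> by (simp add: u_def k absF_divide absF_mult field_simps)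
    then have "mat2 u 0 0 1 \<in> K2" by (intro mat2_in_K2) auto
    moreover have "mat2 \<alpha> \<beta> 0 \<delta> = mat2 \<beta> 0 0 \<delta> ** eta p k ** mat2 u 0 0 1"
      using p0 \<open>\<beta> \<noteq> 0\<close> by (intro mat2_eqI) (simp_all add: eta_eq matrix_mult_nth_2 u_def)
    ultimately show ?thesis
      using \<open>\<beta> \<noteq> 0\<close> nz K2_mult[OF _ h1(1)] that[of \<beta> \<delta> "mat2 u 0 0 1 ** h1" k]
      by (simp add: g matrix_mul_assoc)
  next
    case False
    \<comment> \<open>\<open>eta p 0\<close> already carries the unipotent entry 1, which is
      subtracted in the correcting matrix.\<close>
    have "absF (\<beta> / \<alpha> - 1) \<le> 1"
      using False nz by (intro absF_diff_le) (auto simp: absF_divide)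
    then have "mat2 1 (\<beta> / \<alpha> - 1) 0 1 \<in> K2" by (intro mat2_in_K2) auto
    moreover have "mat2 \<alpha> \<beta> 0 \<delta> = mat2 \<alpha> 0 0 \<delta> ** eta p 0 ** mat2 1 (\<beta> / \<alpha> - 1) 0 1"
      using nz by (intro mat2_eqI) (simp_all add: eta_eq matrix_mult_nth_2 field_simps)
    ultimately show ?thesis
      using nz K2_mult[OF _ h1(1)] that[of \<alpha> \<delta> "mat2 1 (\<beta> / \<alpha> - 1) 0 1 ** h1" 0]
      by (simp add: g matrix_mul_assoc)
  qed
qed

text \<open>Moving \<open>mat2 0 1 a 1\<close> past the diagonal matrix produces the scalar
  \<open>t2\<close> and replaces \<open>a\<close> by \<open>t1 / t2 * a\<close>. The scalar has
  trivial modular character, and evaluating \<open>\<sigma>\<close> at the new argument costs the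
  factor \<open>\<sigma> (t1 / t2)\<close>.\<close>

lemma W_integrand_torus:
  fixes t1 t2 a :: "'a::nonarch_local_field"
  assumes ur: "unramified_quasicharacter \<xi>1" "unramified_quasicharacter \<xi>2" "unramified_quasicharacter \<sigma>"
    and nz: "t1 \<noteq> 0" "t2 \<noteq> 0" "a \<noteq> 0" and g: "g \<in> GL2" and h: "h \<in> K2"
  shows "W_integrand \<sigma> (right_transl (mat2 t1 0 0 t2 ** g ** h) (spherical_fun \<xi>1 \<xi>2)) a =
    \<xi>1 t2 * \<xi>2 t2 * \<sigma> (t1 / t2) * W_integrand \<sigma> (right_transl g (spherical_fun \<xi>1 \<xi>2)) (t1 / t2 * a)"
proof -
  let ?f = "spherical_fun \<xi>1 \<xi>2" and ?a = "t1 / t2 * a"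
  have a: "?a \<noteq> 0" using nz by simp
  have T: "mat2 t1 0 0 t2 \<in> GL2" "mat2 0 1 a 1 \<in> GL2" "mat2 0 1 ?a 1 \<in> GL2"
    "mat2 t2 0 0 t2 \<in> B2"
    using nz by (auto simp: GL2_iff B2_def)
  have "mat2 0 1 a 1 ** mat2 t1 0 0 t2 = mat2 t2 0 0 t2 ** mat2 0 1 ?a 1"
    using nz by (intro mat2_eqI) (simp_all add: matrix_mult_nth_2)
  then have eq: "mat2 0 1 a 1 ** (mat2 t1 0 0 t2 ** g ** h) = mat2 t2 0 0 t2 ** (mat2 0 1 ?a 1 ** g) ** h"
    by (simp add: matrix_mul_assoc)
  have G: "mat2 0 1 ?a 1 ** g \<in> GL2" "mat2 t2 0 0 t2 ** (mat2 0 1 ?a 1 ** g) \<in> GL2"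
    "mat2 t1 0 0 t2 ** g ** h \<in> GL2"
    using T g K2_subset_GL2[OF h] by (auto intro!: GL2_mult simp: B2_def)
  have "?f (mat2 0 1 a 1 ** (mat2 t1 0 0 t2 ** g ** h)) = ?f (mat2 t2 0 0 t2 ** (mat2 0 1 ?a 1 ** g))"
    unfolding eq by (intro spherical_fun_mult_K2 ur G h)
  also have "\<dots> = \<xi>1 t2 * \<xi>2 t2 * ?f (mat2 0 1 ?a 1 ** g)"
    using nz by (subst spherical_fun_mult_B2[OF ur(1,2) G(1) T(4)]) (simp add: borel_char_def modular_B2_def)
  finally have f: "?f (mat2 0 1 a 1 ** (mat2 t1 0 0 t2 ** g ** h)) = \<xi>1 t2 * \<xi>2 t2 * ?f (mat2 0 1 ?a 1 ** g)" .
  have "\<sigma> ?a = \<sigma> (t1 / t2) * \<sigma> a"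
    using nz by (intro unramified_mult ur) auto
  then have s: "inverse (\<sigma> a) = \<sigma> (t1 / t2) * inverse (\<sigma> ?a)"
    using unramified_nonzero[OF ur(3)] nz by simp
  show ?thesis
    unfolding W_integrand_spherical[OF G(3) nz(3)] W_integrand_spherical[OF g a] f s by simp
qed

text \<open>Invariance of the measure under multiplication by \<open>t1 / t2\<close> absorbs the
  translated argument.\<close>

lemma has_bochner_integral_torus:
  fixes t1 t2 :: "'a::nonarch_local_field" and \<mu> :: "'a measure"
  assumes ur: "unramified_quasicharacter \<xi>1" "unramified_quasicharacter \<xi>2" "unramified_quasicharacter \<sigma>"
    and \<mu>: "mult_haar_measure \<mu>"
    and nz: "t1 \<noteq> 0" "t2 \<noteq> 0" and g: "g \<in> GL2" and h: "h \<in> K2"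
    and I: "has_bochner_integral \<mu> (W_integrand \<sigma> (right_transl g (spherical_fun \<xi>1 \<xi>2))) I"
  shows "has_bochner_integral \<mu> (W_integrand \<sigma> (right_transl (mat2 t1 0 0 t2 ** g ** h) (spherical_fun \<xi>1 \<xi>2)))
    (\<xi>1 t2 * \<xi>2 t2 * \<sigma> (t1 / t2) * I)"
proof -
  let ?J = "W_integrand \<sigma> (right_transl g (spherical_fun \<xi>1 \<xi>2))" and ?c = "t1 / t2"
  have c: "?c \<noteq> 0" using nz by simp
  note meas = mult_haar_measurable_times[OF \<mu> c] and distr = mult_haar_distr[OF \<mu> c]
  have J: "integrable \<mu> ?J" "integral\<^sup>L \<mu> ?J = I"
    using I by (auto simp: has_bochner_integral_iff)
  have "integrable \<mu> (\<lambda>a. ?J (?c * a))"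
    using integrable_distr[OF meas, of ?J] J(1) unfolding distr by blast
  moreover have "(LINT a|\<mu>. ?J (?c * a)) = I"
    using integral_distr[OF meas, of ?J] J unfolding distr by auto
  ultimately have "has_bochner_integral \<mu> (\<lambda>a. ?J (?c * a)) I"
    by (simp add: has_bochner_integral_iff)
  then have "has_bochner_integral \<mu> (\<lambda>a. \<xi>1 t2 * \<xi>2 t2 * \<sigma> ?c * ?J (?c * a)) (\<xi>1 t2 * \<xi>2 t2 * \<sigma> ?c * I)"
    by (intro has_bochner_integral_mult_right)
  then show ?thesis
    by (subst has_bochner_integral_cong[OF refl W_integrand_torus[OF ur nz _ g h] refl])
      (use mult_haar_space[OF \<mu>] in auto)
qed

section \<open>The normalized function on a double coset\<close>

lemma unramified_in_range_norms:
  fixes p :: "'a::nonarch_local_field"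
  assumes "uniformizer p" "unramified_in_range p \<xi>1 \<xi>2 \<sigma>"
  shows "norm (\<xi>1 p * inverse (\<sigma> p) * complex_of_real (sqrt (absF p))) < 1"
    "norm (inverse (\<xi>2 p) * \<sigma> p * complex_of_real (sqrt (absF p))) < 1"
proof -
  have Q: "sqrt (absF p) > 0" using assms(1) by (simp add: uniformizer_nonzero)
  have "real (card (residue_field :: 'a set set)) powr (1/2) = 1 / sqrt (absF p)"
    using absF_uniformizer[OF assms(1)] by (simp add: powr_half_sqrt real_sqrt_divide)
  then have "norm (\<xi>1 p * inverse (\<sigma> p)) < 1 / sqrt (absF p)" "norm (inverse (\<xi>2 p) * \<sigma> p) < 1 / sqrt (absF p)"
    using assms(2) by (simp_all add: unramified_in_range_def)
  moreover have "norm (z * complex_of_real (sqrt (absF p))) < 1" if "norm z < 1 / sqrt (absF p)" for z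
    using that Q by (simp add: norm_mult pos_less_divide_eq)
  ultimately show "norm (\<xi>1 p * inverse (\<sigma> p) * complex_of_real (sqrt (absF p))) < 1"
    "norm (inverse (\<xi>2 p) * \<sigma> p * complex_of_real (sqrt (absF p))) < 1"
    by blast+
qed

text \<open>As these double cosets exhaust \<open>GL2\<close>, convergence, the explicit formula and
  the continuation are all read off from here.\<close>

lemma Wnorm_torus_eta:
  fixes p :: "'a::nonarch_local_field" and \<mu> :: "'a measure" and k :: nat
  assumes p: "uniformizer p" and \<mu>: "mult_haar_measure \<mu>" and range: "unramified_in_range p \<xi>1 \<xi>2 \<sigma>"
    and nz: "t1 \<noteq> 0" "t2 \<noteq> 0" and h: "h \<in> K2"
  defines "g \<equiv> mat2 t1 0 0 t2 ** eta p k ** h"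
  shows "integrable \<mu> (W_integrand \<sigma> (right_transl g (spherical_vector \<xi>1 \<xi>2)))"
    "Wnorm \<mu> p \<xi>1 \<xi>2 \<sigma> g =
      \<xi>1 t2 * \<xi>2 t2 * \<sigma> (t1 / t2) * continued_value (absF p) k (\<xi>1 p, \<xi>2 p, \<sigma> p)"
proof -
  have ur: "unramified_quasicharacter \<xi>1" "unramified_quasicharacter \<xi>2" "unramified_quasicharacter \<sigma>"
    using range by (auto simp: unramified_in_range_def)
  have p0: "p \<noteq> 0" using p by (rule uniformizer_nonzero)
  have Q: "0 < absF p" "absF p < 1" using p p0 by (simp_all add: uniformizer_less_1)
  have q: "real (card (residue_field :: 'a set set)) = inverse (absF p)"
    using absF_uniformizer[OF p] by simp
  have r: "inverse (absF p) powr (-1/2) = sqrt (absF p)"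
    using Q by (simp add: powr_minus powr_half_sqrt real_sqrt_inverse flip: minus_divide_left)
  note norms = unramified_in_range_norms[OF p range]
  note int = has_bochner_integral_torus[OF ur \<mu> nz eta_in_GL2[OF p0] h has_bochner_integral_eta[OF p \<mu> ur norms, where k = k],
      folded g_def spherical_vector_eq[OF ur(1,2)]]
  from int show "integrable \<mu> (W_integrand \<sigma> (right_transl g (spherical_vector \<xi>1 \<xi>2)))"
    by (rule has_bochner_integral_iff[THEN iffD1, THEN conjunct1])
  have "\<xi>1 p \<noteq> 0" "\<xi>2 p \<noteq> 0" "\<sigma> p \<noteq> 0" using ur p0 by (auto simp: unramified_nonzero)
  note eq = eta_integral_normalized[OF Q this norms, of k]
  show "Wnorm \<mu> p \<xi>1 \<xi>2 \<sigma> g =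
      \<xi>1 t2 * \<xi>2 t2 * \<sigma> (t1 / t2) * continued_value (absF p) k (\<xi>1 p, \<xi>2 p, \<sigma> p)"
    unfolding Wnorm_def Wa_def W_functional_def has_bochner_integral_integral_eq[OF int] Let_def q r
      inverse_inverse_eq eq[symmetric]
    by (simp only: mult_ac)
qed

text \<open>Holomorphy of \<open>R\<close> on all of \<open>Cstar3\<close> together with agreement
  off the diagonal expresses the analytic continuation to equal parameters. \<open>R\<close> and
  \<open>C\<close> are chosen before the characters, so they are functions of the parameters
  alone.\<close>

theorem theorem1p1:
  fixes \<pi> :: "'a::nonarch_local_field" and \<mu> :: "'a measure" and q :: real
  assumes "CHAR('a) \<noteq> 2"
    and "uniformizer \<pi>"
    and "mult_haar_measure \<mu>"
    and "q = real (card (residue_field :: 'a set set))"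
  shows "(\<forall>\<xi>1 \<xi>2 \<sigma>. \<forall>g\<in>GL2. unramified_in_range \<pi> \<xi>1 \<xi>2 \<sigma> \<longrightarrow>
            integrable \<mu> (W_integrand \<sigma> (right_transl g (spherical_vector \<xi>1 \<xi>2))))
    \<and> (\<forall>k. \<exists>R. holomorphic3_on R Cstar3 \<and>
          (\<forall>\<gamma>1 \<gamma>2 \<tau>. (\<gamma>1, \<gamma>2, \<tau>) \<in> Cstar3 \<longrightarrow> \<gamma>1 \<noteq> \<gamma>2 \<longrightarrow>
             R (\<gamma>1, \<gamma>2, \<tau>) = explicit_value q k \<gamma>1 \<gamma>2 \<tau>) \<and>
          (\<forall>\<xi>1 \<xi>2 \<sigma>. unramified_in_range \<pi> \<xi>1 \<xi>2 \<sigma> \<longrightarrow>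
             Wnorm \<mu> \<pi> \<xi>1 \<xi>2 \<sigma> (eta \<pi> k) = R (\<xi>1 \<pi>, \<xi>2 \<pi>, \<sigma> \<pi>)))
    \<and> (\<forall>g\<in>GL2. \<exists>C. holomorphic3_on C Cstar3 \<and>
          (\<forall>\<xi>1 \<xi>2 \<sigma>. unramified_in_range \<pi> \<xi>1 \<xi>2 \<sigma> \<longrightarrow>
             Wnorm \<mu> \<pi> \<xi>1 \<xi>2 \<sigma> g = C (\<xi>1 \<pi>, \<xi>2 \<pi>, \<sigma> \<pi>)) \<and>
          (\<forall>\<gamma>1 \<gamma>2 \<tau>. (\<gamma>1, \<gamma>2, \<tau>) \<in> Cstar3 \<longrightarrow> C (\<gamma>1, \<gamma>2, \<tau>) = C (\<gamma>2, \<gamma>1, \<tau>)))"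
proof (intro conjI allI ballI impI)
  have p0: "\<pi> \<noteq> 0" using assms(2) by (rule uniformizer_nonzero)
  have Q: "0 < absF \<pi>" "absF \<pi> < 1" using assms(2) p0 by (simp_all add: uniformizer_less_1)
  have q: "q = inverse (absF \<pi>)"
    using absF_uniformizer[OF assms(2)] assms(4) by simp
  show "integrable \<mu> (W_integrand \<sigma> (right_transl g (spherical_vector \<xi>1 \<xi>2)))"
    if "g \<in> GL2" "unramified_in_range \<pi> \<xi>1 \<xi>2 \<sigma>" for \<xi>1 \<xi>2 \<sigma> g
    using torus_eta_K2_decomposition[OF assms(2) that(1)] Wnorm_torus_eta(1)[OF assms(2,3) that(2)] by metis
  show "\<exists>R. holomorphic3_on R Cstar3 \<and>
          (\<forall>\<gamma>1 \<gamma>2 \<tau>. (\<gamma>1, \<gamma>2, \<tau>) \<in> Cstar3 \<longrightarrow> \<gamma>1 \<noteq> \<gamma>2 \<longrightarrow>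
             R (\<gamma>1, \<gamma>2, \<tau>) = explicit_value q k \<gamma>1 \<gamma>2 \<tau>) \<and>
          (\<forall>\<xi>1 \<xi>2 \<sigma>. unramified_in_range \<pi> \<xi>1 \<xi>2 \<sigma> \<longrightarrow>
             Wnorm \<mu> \<pi> \<xi>1 \<xi>2 \<sigma> (eta \<pi> k) = R (\<xi>1 \<pi>, \<xi>2 \<pi>, \<sigma> \<pi>))" for k
  proof (intro exI[of _ "continued_value (absF \<pi>) k"] conjI allI impI holomorphic3_continued_value)
    show "Wnorm \<mu> \<pi> \<xi>1 \<xi>2 \<sigma> (eta \<pi> k) = continued_value (absF \<pi>) k (\<xi>1 \<pi>, \<xi>2 \<pi>, \<sigma> \<pi>)"
      if "unramified_in_range \<pi> \<xi>1 \<xi>2 \<sigma>" for \<xi>1 \<xi>2 \<sigma>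
    proof -
      \<comment> \<open>\<open>eta \<pi> k\<close> lies in its own double coset, with trivial torus
        and \<open>K2\<close> parts.\<close>
      have 1: "mat2 1 0 0 1 = (mat 1 :: 'a^2^2)"
        by (rule mat2_eqI) (simp_all add: mat_def)
      have "mat2 1 0 0 1 \<in> (K2 :: ('a^2^2) set)" by (intro mat2_in_K2) auto
      from Wnorm_torus_eta(2)[OF assms(2,3) that _ _ this, of 1 1 k] show ?thesis
        using that by (simp add: 1 unramified_in_range_def unramified_1)
    qed
  qed (use Q in \<open>auto simp: continued_value_eq_explicit q Cstar3_def\<close>)
  show "\<exists>C. holomorphic3_on C Cstar3 \<and>
          (\<forall>\<xi>1 \<xi>2 \<sigma>. unramified_in_range \<pi> \<xi>1 \<xi>2 \<sigma> \<longrightarrow>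
             Wnorm \<mu> \<pi> \<xi>1 \<xi>2 \<sigma> g = C (\<xi>1 \<pi>, \<xi>2 \<pi>, \<sigma> \<pi>)) \<and>
          (\<forall>\<gamma>1 \<gamma>2 \<tau>. (\<gamma>1, \<gamma>2, \<tau>) \<in> Cstar3 \<longrightarrow> C (\<gamma>1, \<gamma>2, \<tau>) = C (\<gamma>2, \<gamma>1, \<tau>))"
    if gGL: "g \<in> GL2" for g
  proof -
    obtain t1 t2 k h where g: "t1 \<noteq> 0" "t2 \<noteq> 0" "h \<in> K2" "g = mat2 t1 0 0 t2 ** eta \<pi> k ** h"
      using torus_eta_K2_decomposition[OF assms(2) gGL] by metis
    \<comment> \<open>The valuations of \<open>t2\<close> and \<open>t1 / t2\<close> are fixed by
      the decomposition of \<open>g\<close> and turn the character values into a monomial; \<gamma>1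
      and \<gamma>2 carry the same exponent \<open>m\<close>, which preserves the symmetry.\<close>
    obtain m where m: "absF t2 = absF \<pi> powi m"
      using absF_eq_powi[OF assms(2) g(2)] by metis
    obtain n where n: "absF (t1 / t2) = absF \<pi> powi n"
      using absF_eq_powi[OF assms(2), of "t1 / t2"] g by auto
    define C where "C = (\<lambda>z. fst z powi m * fst (snd z) powi m * snd (snd z) powi n * continued_value (absF \<pi>) k z)"
    show ?thesis
    proof (intro exI[of _ C] conjI allI impI)
      show "holomorphic3_on C Cstar3"
        unfolding C_def
        by (intro holomorphic3_mult holomorphic3_power_int holomorphic3_proj holomorphic3_continued_value)
          (auto simp: Cstar3_def)
      show "Wnorm \<mu> \<pi> \<xi>1 \<xi>2 \<sigma> g = C (\<xi>1 \<pi>, \<xi>2 \<pi>, \<sigma> \<pi>)" if "unramified_in_range \<pi> \<xi>1 \<xi>2 \<sigma>" for \<xi>1 \<xi>2 \<sigma>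
        using that Wnorm_torus_eta(2)[OF assms(2,3) that g(1-3), of k] p0 m n
        by (simp add: C_def g(4) unramified_in_range_def unramified_eq_powi[of _ \<pi>])
      show "C (\<gamma>1, \<gamma>2, \<tau>) = C (\<gamma>2, \<gamma>1, \<tau>)" if "(\<gamma>1, \<gamma>2, \<tau>) \<in> Cstar3" for \<gamma>1 \<gamma>2 \<tau>
        using that continued_value_commute[OF Q, of \<gamma>1 \<gamma>2 \<tau> k] by (simp add: C_def Cstar3_def mult_ac)
    qed
  qed
qed

end
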